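(* Let $(P,\preceq)$ be a finite connected poset with $|P|\ge 2$. Let $\mathcal{K}(P)$ be the abstract simplicial complex whose vertices are the proper pipes of $P$ and whose simplices are the proper pipings of $P$. Then there exists a simplicial $(|P|-2)$-dimensional convex polytope $\mathcal{A}(P)^*$ whose boundary complex is isomorphic to $\mathcal{K}(P)$.
   Context: A finite poset $(P,\preceq)$ is connected if its Hasse diagram is a connected graph. A subset $\tau\subseteq P$ is convex if $i\prec j\prec k$ with $i,k\in\tau$ implies $j\in\tau$; it is connected if the subgraph of the Hasse diagram of $P$ induced by $\tau$ is connected. A pipe is a nonempty convex connected subset $\tau\subseteq P$. Two sets are nested if one of them contains the other. A piping is a collection $\mathbf{T}$ of pipes such that any two elements of $\mathbf{T}$ are either nested or disjoint, and such that the directed graph $D_{\mathbf{T}}$ with vertex set $\mathbf{T}$ and edge set $\{(\tau,\tau')\in\mathbf{T}^2 : \tau\cap\tau'=\emptyset \text{ and } i\prec j\text{ for some } i\in\tau, j\in\tau'\}$ has no directed cycles. A pipe $\tau$ is proper if $1<|\tau|<|P|$. A piping is proper if all its elements are proper pipes (the empty collection is a proper piping). A subset of a proper piping is a proper piping. *)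

theory Defs
  imports "HOL-Analysis.Analysis"
begin

section \<open>Pipes and pipings\<close>

text \<open>A finite poset is a type of class \<open>{finite, order}\<close>; the poset itself is \<open>UNIV\<close>.\<close>

definition covered_by :: "'p::order \<Rightarrow> 'p \<Rightarrow> bool" where
  "covered_by i j \<longleftrightarrow> i < j \<and> \<not> (\<exists>k. i < k \<and> k < j)"

definition hasse_edges_on :: "'p::order set \<Rightarrow> ('p \<times> 'p) set" where
  "hasse_edges_on S = {(i, j). i \<in> S \<and> j \<in> S \<and> (covered_by i j \<or> covered_by j i)}"

text \<open>The covering relation is that of the whole poset, so this is connectedness of the
  subgraph induced by \<open>S\<close> in the Hasse diagram of the poset, not of the Hasse diagram of the
  suborder on \<open>S\<close>. The empty set counts as connected here; nonemptiness is asked for separately.\<close>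

definition hasse_connected :: "'p::order set \<Rightarrow> bool" where
  "hasse_connected S \<longleftrightarrow> (\<forall>i\<in>S. \<forall>j\<in>S. (i, j) \<in> (hasse_edges_on S)\<^sup>*)"

definition order_convex :: "'p::order set \<Rightarrow> bool" where
  "order_convex S \<longleftrightarrow> (\<forall>i\<in>S. \<forall>k\<in>S. \<forall>j. i < j \<and> j < k \<longrightarrow> j \<in> S)"

definition pipe :: "'p::order set \<Rightarrow> bool" where
  "pipe \<tau> \<longleftrightarrow> \<tau> \<noteq> {} \<and> order_convex \<tau> \<and> hasse_connected \<tau>"

definition nested :: "'a set \<Rightarrow> 'a set \<Rightarrow> bool" where
  "nested A B \<longleftrightarrow> A \<subseteq> B \<or> B \<subseteq> A"

definition piping_digraph :: "'p::order set set \<Rightarrow> ('p set \<times> 'p set) set" where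
  "piping_digraph T =
     {(\<tau>, \<tau>'). \<tau> \<in> T \<and> \<tau>' \<in> T \<and> \<tau> \<inter> \<tau>' = {} \<and> (\<exists>i\<in>\<tau>. \<exists>j\<in>\<tau>'. i < j)}"

definition piping :: "'p::order set set \<Rightarrow> bool" where
  "piping T \<longleftrightarrow>
     (\<forall>\<tau>\<in>T. pipe \<tau>) \<and>
     (\<forall>\<tau>\<in>T. \<forall>\<tau>'\<in>T. nested \<tau> \<tau>' \<or> disjnt \<tau> \<tau>') \<and>
     acyclic (piping_digraph T)"

definition proper_pipe :: "'p::{finite,order} set \<Rightarrow> bool" where
  "proper_pipe \<tau> \<longleftrightarrow> pipe \<tau> \<and> 1 < card \<tau> \<and> card \<tau> < CARD('p)"

definition proper_piping :: "'p::{finite,order} set set \<Rightarrow> bool" where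
  "proper_piping T \<longleftrightarrow> piping T \<and> (\<forall>\<tau>\<in>T. proper_pipe \<tau>)"

section \<open>Simplicial complexes and simplicial polytopes\<close>

text \<open>An abstract simplicial complex is given by its set \<open>K\<close> of simplices (the empty simplex
  included); its vertex set is \<open>\<Union>K\<close>.\<close>

definition piping_complex :: "'p::{finite,order} set set set" where
  "piping_complex = {T. proper_piping T}"

lemma vertices_piping_complex:
  "\<Union>(piping_complex :: 'p::{finite,order} set set set) = {\<tau>. proper_pipe \<tau>}"
proof -
  have "proper_piping {\<tau>}" if \<tau>: "proper_pipe \<tau>" for \<tau> :: "'p set"
  proof -
    have "\<tau> \<noteq> {}"
      using \<tau> by (auto simp: proper_pipe_def pipe_def)
    then have "piping_digraph {\<tau>} = {}"
      by (auto simp: piping_digraph_def)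
    then show ?thesis
      using \<tau> by (auto simp: proper_piping_def piping_def proper_pipe_def nested_def acyclic_def)
  qed
  then show ?thesis
    by (auto simp: piping_complex_def proper_piping_def)
qed

lemma piping_complex_mono:
  assumes "T \<in> piping_complex" and "T' \<subseteq> T"
  shows "T' \<in> piping_complex"
proof -
  have "piping_digraph T' \<subseteq> piping_digraph T"
    using assms(2) by (auto simp: piping_digraph_def)
  then have "acyclic (piping_digraph T) \<Longrightarrow> acyclic (piping_digraph T')"
    by (rule acyclic_subset[rotated])
  then show ?thesis
    using assms by (auto simp: piping_complex_def proper_piping_def piping_def subset_iff)
qed

definition complex_isomorphic :: "'a set set \<Rightarrow> 'b set set \<Rightarrow> bool" where
  "complex_isomorphic K L \<longleftrightarrow>
     (\<exists>f. bij_betw f (\<Union>K) (\<Union>L) \<and> (\<forall>\<sigma>. \<sigma> \<subseteq> \<Union>K \<longrightarrow> (\<sigma> \<in> K \<longleftrightarrow> f ` \<sigma> \<in> L)))"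

definition simplicial_polytope :: "'e::euclidean_space set \<Rightarrow> bool" where
  "simplicial_polytope Q \<longleftrightarrow>
     polytope Q \<and> (\<forall>F. F face_of Q \<and> F \<noteq> Q \<longrightarrow> (\<exists>n. n simplex F))"

text \<open>Each proper face, the empty one included, is recorded by its set of vertices. For a single
  point the only proper face is \<open>{}\<close>, so the complex is \<open>{{}}\<close> and has no vertices.\<close>

definition boundary_complex :: "'e::euclidean_space set \<Rightarrow> 'e set set" where
  "boundary_complex Q = {{v. v extreme_point_of F} | F. F face_of Q \<and> F \<noteq> Q}"

end

theory Submission imports Defs begin

text \<open>For a set \<open>S\<close> of poset elements let \<open>a\<^sub>S(x)\<close> be the sum of \<open>x\<^sub>j - x\<^sub>i\<close> over the covers
  \<open>i < j\<close> inside \<open>S\<close>, and let \<open>h\<^sub>S\<close> be \<open>M\<close> to the power \<open>|S|\<close> for a huge constant \<open>M\<close>. The inequalities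
  \<open>a\<^sub>S(x) \<ge> h\<^sub>S\<close> for all pipes \<open>S\<close> with at least two elements, together with equality for the whole
  poset, describe a simple polytope modulo constant vectors, and the required polytope is its
  polar dual with respect to an interior point.

  The pipes that are tight at a feasible point form a piping: if two of them crossed, or some of
  them formed a directed cycle, then all coordinates on the convex hull of their union would lie
  within a bounded multiple of the largest \<open>h\<^sub>S\<close> involved, contradicting the inequality of that hull.

  Conversely, given a piping \<open>T\<close> containing the whole poset, acyclicity provides for each \<open>\<tau>\<close> in \<open>T\<close>
  a function \<open>g\<^sub>\<tau>\<close> that vanishes outside \<open>\<tau>\<close>, is constant on the maximal members of \<open>T\<close> inside
  \<open>\<tau>\<close>, and increases otherwise. The matrix \<open>a\<^sub>\<sigma>(g\<^sub>\<tau>)\<close> is triangular with respect to inclusion. Hence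
  the \<open>a\<^sub>\<sigma>\<close> are linearly independent, so the dual is simplicial, and one can solve for a combination
  of the \<open>g\<^sub>\<tau>\<close> at which exactly the members of \<open>T\<close> are tight.\<close>

section \<open>Polar duals\<close>

text \<open>\<open>K\<close> lists the tight sets of the body of all \<open>y\<close> in
  \<open>L\<close> with \<open>v a \<bullet> y \<le> 1\<close>, so the faces of the hull are read
  off without treating that body as a polytope. \<open>pos\<close> puts the origin in the relative
  interior of the hull, and \<open>indep\<close> makes every proper face a simplex.\<close>

lemma polar_simplicial:
  fixes v :: "'a \<Rightarrow> 'e::euclidean_space"
  assumes fin: "finite V" and L: "subspace L" and vL: "\<And>a. a \<in> V \<Longrightarrow> v a \<in> L"
    and pos: "\<And>y. y \<in> L \<Longrightarrow> (\<And>a. a \<in> V \<Longrightarrow> v a \<bullet> y \<le> 0) \<Longrightarrow> y = 0"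
    and tight: "\<And>y. y \<in> L \<Longrightarrow> (\<And>a. a \<in> V \<Longrightarrow> v a \<bullet> y \<le> 1) \<Longrightarrow> {a\<in>V. v a \<bullet> y = 1} \<in> K"
    and ex: "\<And>\<sigma>. \<sigma> \<in> K \<Longrightarrow> \<exists>y\<in>L. (\<forall>a\<in>V. v a \<bullet> y \<le> 1) \<and> {a\<in>V. v a \<bullet> y = 1} = \<sigma>"
    and indep: "\<And>\<sigma> u a. \<sigma> \<in> K \<Longrightarrow> (\<Sum>b\<in>\<sigma>. u b *\<^sub>R v b) = 0 \<Longrightarrow> a \<in> \<sigma> \<Longrightarrow> u a = 0"
    and vert: "\<And>a. a \<in> V \<Longrightarrow> {a} \<in> K"
  shows "\<exists>Q :: 'e set. simplicial_polytope Q \<and> aff_dim Q = int (dim L) \<and>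
           complex_isomorphic (boundary_complex Q) K"
proof -
  \<comment> \<open>Including 0 makes \<open>0 \<in> Q\<close> immediate, and 0 never lies on a face
    \<open>y \<bullet> x = 1\<close>.\<close>
  define W where "W = insert 0 (v ` V)"
  define Q where "Q = convex hull W"
  have W: "finite W" "W \<subseteq> L"
    using fin vL L by (auto simp: W_def subspace_0)
  have KV: "\<sigma> \<subseteq> V" if "\<sigma> \<in> K" for \<sigma>
    using ex[OF that] by blast
  have UK: "\<Union>K = V"
    using KV vert by blast
  have inj: "inj_on v V"
  proof (rule inj_onI)
    fix a b assume ab: "a \<in> V" "b \<in> V" "v a = v b"
    \<comment> \<open>Since \<open>{a}\<close> lies in \<open>K\<close>, some \<open>y\<close> is
      tight at \<open>a\<close> alone and so separates it from \<open>b\<close>.\<close>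
    obtain y where "{c\<in>V. v c \<bullet> y = 1} = {a}"
      using ex[OF vert[OF ab(1)]] by blast
    then show "a = b"
      using ab by (metis (mono_tags, lifting) mem_Collect_eq singletonD singletonI)
  qed
  have vK_indep: "independent (v ` \<sigma>)" if "\<sigma> \<in> K" for \<sigma>
  proof -
    have inj': "inj_on v \<sigma>" using inj KV[OF that] inj_on_subset by blast
    have fin': "finite \<sigma>" using fin KV[OF that] finite_subset by blast
    show ?thesis
    proof (rule independent_if_scalars_zero)
      show "finite (v ` \<sigma>)" using fin' by simp
      fix f x assume "(\<Sum>x\<in>v ` \<sigma>. f x *\<^sub>R x) = 0" "x \<in> v ` \<sigma>"
      then show "f x = 0"
        using indep[OF that, of "\<lambda>a. f (v a)"] by (auto simp: sum.reindex[OF inj'] o_def)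
    qed
  qed
  have vK_aff: "\<not> affine_dependent (v ` \<sigma>)" if "\<sigma> \<in> K" for \<sigma>
    using vK_indep[OF that] affine_dependent_imp_dependent by blast
  \<comment> \<open>A face may come with a normal \<open>c\<close> outside \<open>L\<close>; its
    orthogonal projection to \<open>L\<close> defines the same functional on
    \<open>Q\<close>.\<close>
  have proj: "\<exists>y\<in>L. \<forall>x\<in>L. x \<bullet> y = x \<bullet> c" for c :: 'e
  proof -
    obtain y z where yz: "y \<in> span L" "\<And>w. w \<in> span L \<Longrightarrow> orthogonal z w" "c = y + z"
      using orthogonal_subspace_decomp_exists[of L c] by metis
    have sL: "span L = L" using L by (simp add: span_eq_iff)
    show ?thesis
      using yz unfolding sL by (auto simp: inner_add_right orthogonal_def inner_commute intro!: bexI[of _ y])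
  qed
  have QL: "Q \<subseteq> L"
    unfolding Q_def using W(2) L by (simp add: hull_minimal subspace_imp_convex)
  have face_eq: "Q \<inter> {x. y \<bullet> x = 1} = convex hull (v ` {a\<in>V. v a \<bullet> y = 1})"
    and face_face: "(Q \<inter> {x. y \<bullet> x = 1}) face_of Q" and face_ne: "Q \<inter> {x. y \<bullet> x = 1} \<noteq> Q"
    if le: "\<forall>a\<in>V. v a \<bullet> y \<le> 1" for y
  proof -
    have WL: "W \<subseteq> {x. y \<bullet> x \<le> 1}"
      using le by (auto simp: W_def inner_commute)
    then have sub: "Q \<subseteq> {x. y \<bullet> x \<le> 1}"
      unfolding Q_def by (simp add: hull_minimal convex_halfspace_le)
    then show fo: "(Q \<inter> {x. y \<bullet> x = 1}) face_of Q"
      by (intro face_of_Int_supporting_hyperplane_le) (auto simp: Q_def)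
    have "0 \<in> Q" unfolding Q_def W_def by (simp add: hull_inc)
    then show "Q \<inter> {x. y \<bullet> x = 1} \<noteq> Q"
      by (metis (mono_tags) Int_iff inner_zero_right mem_Collect_eq zero_neq_one)
    obtain S' where S': "S' \<subseteq> W" "Q \<inter> {x. y \<bullet> x = 1} = convex hull S'"
      using face_of_convex_hull_subset[OF finite_imp_compact[OF W(1)] fo[unfolded Q_def]]
      unfolding Q_def by auto
    have "S' \<subseteq> v ` {a\<in>V. v a \<bullet> y = 1}"
    proof
      fix s assume s: "s \<in> S'"
      then have "s \<in> Q \<inter> {x. y \<bullet> x = 1}" using S'(2) by (simp add: hull_inc)
      then show "s \<in> v ` {a\<in>V. v a \<bullet> y = 1}"
        using s S'(1) by (auto simp: W_def inner_commute)
    qed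
    moreover have "convex hull (v ` {a\<in>V. v a \<bullet> y = 1}) \<subseteq> Q \<inter> {x. y \<bullet> x = 1}"
    proof (rule hull_minimal)
      show "v ` {a \<in> V. v a \<bullet> y = 1} \<subseteq> Q \<inter> {x. y \<bullet> x = 1}"
        unfolding Q_def W_def by (auto intro!: hull_inc simp: inner_commute)
      show "convex (Q \<inter> {x. y \<bullet> x = 1})"
        unfolding Q_def by (intro convex_Int convex_convex_hull convex_hyperplane)
    qed
    ultimately show "Q \<inter> {x. y \<bullet> x = 1} = convex hull (v ` {a\<in>V. v a \<bullet> y = 1})"
      using S'(2) by (metis hull_mono subset_antisym)
  qed
  have polyQ: "polytope Q"
    unfolding Q_def polytope_def using W(1) by blast
  have faces: "F face_of Q \<and> F \<noteq> Q \<longleftrightarrow> (\<exists>\<sigma>\<in>K. F = convex hull (v ` \<sigma>))" for F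
  proof
    assume F: "F face_of Q \<and> F \<noteq> Q"
    then have "F exposed_face_of Q"
      using exposed_face_of_polyhedron polytope_imp_polyhedron[OF polyQ] by blast
    then obtain c b where cb: "Q \<subseteq> {x. c \<bullet> x \<le> b}" "F = Q \<inter> {x. c \<bullet> x = b}"
      unfolding exposed_face_of_def by blast
    obtain y0 where y0: "y0 \<in> L" "\<And>x. x \<in> L \<Longrightarrow> x \<bullet> y0 = x \<bullet> c"
      using proj[of c] by blast
    have "0 \<in> Q" unfolding Q_def W_def by (simp add: hull_inc)
    then have b0: "b \<ge> 0" using cb by auto
    have vQ: "v a \<in> Q" if "a \<in> V" for a
      unfolding Q_def W_def using that by (simp add: hull_inc)
    have le: "v a \<bullet> y0 \<le> b" if "a \<in> V" for a
      using vQ[OF that] cb(1) y0(2)[OF vL[OF that]] by (auto simp: inner_commute)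
    \<comment> \<open>For \<open>b = 0\<close>, \<open>pos\<close> would kill the projected normal
      and the face would be all of \<open>Q\<close>. Hence the normal can be scaled to level
      1.\<close>
    have "b \<noteq> 0"
    proof
      assume "b = 0"
      then have "y0 = 0" using pos[OF y0(1)] le by auto
      then have "c \<bullet> x = 0" if "x \<in> Q" for x
        using y0(2)[of x] that QL by (auto simp: inner_commute)
      then have "F = Q" using cb(2) \<open>b = 0\<close> by auto
      with F show False by simp
    qed
    then have bpos: "b > 0" using b0 by simp
    define y where "y = y0 /\<^sub>R b"
    have yL: "y \<in> L" unfolding y_def using y0(1) L by (simp add: subspace_scale)
    have yle: "v a \<bullet> y \<le> 1" if "a \<in> V" for a
      unfolding y_def using le[OF that] bpos by (simp add: field_simps)
    have "F = Q \<inter> {x. y \<bullet> x = 1}"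
      unfolding cb(2) y_def using QL y0(2) bpos
      by (auto simp: inner_commute field_simps subset_iff)
    then show "\<exists>\<sigma>\<in>K. F = convex hull (v ` \<sigma>)"
      using face_eq[of y] tight[OF yL] yle by blast
  next
    assume "\<exists>\<sigma>\<in>K. F = convex hull (v ` \<sigma>)"
    then obtain \<sigma> where s: "\<sigma> \<in> K" "F = convex hull (v ` \<sigma>)" by blast
    then obtain y where y: "\<forall>a\<in>V. v a \<bullet> y \<le> 1" "{a\<in>V. v a \<bullet> y = 1} = \<sigma>"
      using ex by blast
    show "F face_of Q \<and> F \<noteq> Q"
      using face_eq[OF y(1)] face_face[OF y(1)] face_ne[OF y(1)] s(2) y(2) by simp
  qed
  have ext: "{x. x extreme_point_of (convex hull (v ` \<sigma>))} = v ` \<sigma>" if "\<sigma> \<in> K" for \<sigma>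
    using extreme_point_of_convex_hull_affine_independent[OF vK_aff[OF that]] by auto
  have bd: "boundary_complex Q = (`) v ` K"
    unfolding boundary_complex_def faces using ext by (auto simp: image_iff)
  have "simplicial_polytope Q"
    unfolding simplicial_polytope_def
  proof (intro conjI allI impI)
    fix F assume "F face_of Q \<and> F \<noteq> Q"
    then obtain \<sigma> where "\<sigma> \<in> K" "F = convex hull (v ` \<sigma>)" using faces by blast
    then show "\<exists>n. n simplex F"
      unfolding simplex_def using vK_aff by (intro exI[of _ "int (card (v ` \<sigma>)) - 1"]) auto
  qed (rule polyQ)
  moreover have "aff_dim Q = int (dim L)"
  proof -
    \<comment> \<open>A nonzero vector of \<open>L\<close> orthogonal to all \<open>v a\<close>
      would contradict \<open>pos\<close>.\<close>
    have "span W = L"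
    proof (rule ccontr)
      assume "span W \<noteq> L"
      then have "span W \<subset> span L"
        using W(2) L by (metis psubsetI span_eq_iff span_minimal)
      then obtain y where y: "y \<noteq> 0" "y \<in> span L" "\<And>x. x \<in> span W \<Longrightarrow> orthogonal y x"
        using orthogonal_to_subspace_exists_gen by metis
      then have "y = 0"
        using L by (intro pos) (auto simp: orthogonal_def W_def inner_commute[of _ y] span_base
            span_eq_iff[THEN iffD2])
      with y show False by simp
    qed
    then have "dim W = dim L" using dim_span by metis
    moreover have "aff_dim Q = aff_dim W" by (simp add: Q_def aff_dim_convex_hull)
    moreover have "aff_dim W = int (dim W)"
      by (rule aff_dim_zero) (simp add: W_def hull_inc)
    ultimately show ?thesis by simp
  qed
  moreover have "complex_isomorphic (boundary_complex Q) K"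
    unfolding complex_isomorphic_def
  proof (intro exI conjI allI impI)
    have U: "\<Union>(boundary_complex Q) = v ` V"
      unfolding bd using UK by auto
    show "bij_betw (inv_into V v) (\<Union>(boundary_complex Q)) (\<Union>K)"
      unfolding U UK using inj by (simp add: bij_betw_inv_into bij_betw_imageI)
    fix S assume "S \<subseteq> \<Union>(boundary_complex Q)"
    then obtain \<tau> where t: "\<tau> \<subseteq> V" "S = v ` \<tau>" unfolding U by (meson subset_imageE)
    then have "inv_into V v ` S = \<tau>" using inj by (simp add: inv_into_image_cancel)
    moreover have "S \<in> boundary_complex Q \<longleftrightarrow> \<tau> \<in> K"
      unfolding bd t(2) using inj t(1) KV by (auto simp: inj_on_image_eq_iff image_iff)
    ultimately show "S \<in> boundary_complex Q \<longleftrightarrow> inv_into V v ` S \<in> K" by simp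
  qed
  ultimately show ?thesis by blast
qed

section \<open>Facet inequalities\<close>

definition covers_in :: "'p::order set \<Rightarrow> ('p \<times> 'p) set" where
  "covers_in S = {(i, j). i \<in> S \<and> j \<in> S \<and> covered_by i j}"

definition slope_vec :: "'p::{finite,order} set \<Rightarrow> real ^ 'p::{finite,order}" where
  "slope_vec S = (\<Sum>(i, j)\<in>covers_in S. axis j 1 - axis i 1)"

lemma slope_vec_inner: "slope_vec S \<bullet> x = (\<Sum>(i, j)\<in>covers_in S. x $ j - x $ i)"
  by (simp add: slope_vec_def inner_sum_left inner_diff_left inner_axis' case_prod_unfold)

lemma card_rel_le: "card (R :: ('p::finite \<times> 'p) set) \<le> CARD('p)\<^sup>2"
  by (metis card_cartesian_product card_mono finite subset_UNIV UNIV_Times_UNIV power2_eq_square)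

lemma slope_vec_le:
  fixes x :: "real ^ 'p::{finite,order}"
  assumes "\<And>i j. (i, j) \<in> covers_in S \<Longrightarrow> x $ j - x $ i \<le> d" and "0 \<le> d"
  shows "slope_vec S \<bullet> x \<le> real CARD('p) ^ 2 * d"
proof -
  have "slope_vec S \<bullet> x \<le> real (card (covers_in S)) * d"
    unfolding slope_vec_inner using assms(1) by (intro sum_bounded_above) auto
  also have "\<dots> \<le> real (CARD('p)\<^sup>2) * d"
    using assms(2) card_rel_le[of "covers_in S"] by (intro mult_right_mono of_nat_mono)
  finally show ?thesis by simp
qed

lemma slope_vec_abs_le:
  fixes x :: "real ^ 'p::{finite,order}"
  assumes "\<And>i. 0 \<le> x $ i \<and> x $ i \<le> d"
  shows "\<bar>slope_vec S \<bullet> x\<bar> \<le> real CARD('p) ^ 2 * d"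
proof -
  have d: "0 \<le> d" using assms by (meson order_trans)
  have "slope_vec S \<bullet> (- x) \<le> real CARD('p) ^ 2 * d" "slope_vec S \<bullet> x \<le> real CARD('p) ^ 2 * d"
    using assms d by (intro slope_vec_le; simp add: algebra_simps add_increasing add_increasing2)+
  then show ?thesis by simp
qed

section \<open>Paths inside convex sets and order hulls\<close>

lemma convex_interval_path:
  fixes i j :: "'p::{finite,order}"
  assumes "order_convex S" "i \<in> S" "j \<in> S" "i \<le> j"
  shows "(i, j) \<in> (covers_in S)\<^sup>*"
  using assms(2-)
proof (induction "card {i..j}" arbitrary: i j rule: less_induct)
  case less
  show ?case
  proof (cases "i = j \<or> covered_by i j")
    case True
    then show ?thesis using less.prems by (auto simp: covers_in_def)
  next
    case False
    then obtain k where k: "i < k" "k < j"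
      using less.prems(3) by (auto simp: covered_by_def order_le_less)
    \<comment> \<open>Convexity keeps the intermediate point in \<open>S\<close>, and both halves
      are shorter intervals.\<close>
    have kS: "k \<in> S" using assms(1) less.prems(1,2) k unfolding order_convex_def by blast
    have "{i..k} \<subset> {i..j}" "{k..j} \<subset> {i..j}"
      using k by (auto simp: atLeastatMost_psubset_iff less_le_not_le intro: order_trans)
    then have "card {i..k} < card {i..j}" "card {k..j} < card {i..j}"
      by (simp_all add: psubset_card_mono)
    then have "(i, k) \<in> (covers_in S)\<^sup>*" "(k, j) \<in> (covers_in S)\<^sup>*"
      using less.hyps less.prems(1,2) kS k by (simp_all add: less_imp_le)
    then show ?thesis by (rule rtrancl_trans)
  qed
qed

lemma hasse_edges_on_mono: "S \<subseteq> T \<Longrightarrow> hasse_edges_on S \<subseteq> hasse_edges_on T"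
  by (auto simp: hasse_edges_on_def)

lemma sym_hasse_edges_on: "sym (hasse_edges_on S)"
  by (auto simp: hasse_edges_on_def sym_def)

lemma hasse_rtrancl_commute: "(i, j) \<in> (hasse_edges_on S)\<^sup>* \<Longrightarrow> (j, i) \<in> (hasse_edges_on S)\<^sup>*"
  by (meson sym_hasse_edges_on sym_rtrancl symD)

lemma convex_interval_connected:
  fixes i j :: "'p::{finite,order}"
  assumes "order_convex S" "i \<in> S" "j \<in> S" "i \<le> j"
  shows "(i, j) \<in> (hasse_edges_on S)\<^sup>*"
proof -
  have "covers_in S \<subseteq> hasse_edges_on S"
    by (auto simp: covers_in_def hasse_edges_on_def)
  then show ?thesis
    using convex_interval_path[OF assms] rtrancl_mono by blast
qed

definition order_hull :: "'p::order set \<Rightarrow> 'p set" where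
  "order_hull U = {k. \<exists>i\<in>U. \<exists>j\<in>U. i \<le> k \<and> k \<le> j}"

lemma subset_order_hull: "U \<subseteq> order_hull U"
  by (auto simp: order_hull_def)

lemma order_convex_order_hull: "order_convex (order_hull U)"
  unfolding order_convex_def order_hull_def
  by (auto; meson order.strict_implies_order order_trans)

text \<open>Each point of the hull lies above some point of \<open>U\<close>, and the interval
  between them stays in the hull.\<close>

lemma hasse_connected_order_hull:
  fixes U :: "'p::{finite,order} set"
  assumes "\<And>i j. i \<in> U \<Longrightarrow> j \<in> U \<Longrightarrow> (i, j) \<in> (hasse_edges_on (order_hull U))\<^sup>*"
  shows "hasse_connected (order_hull U)"
proof -
  have "\<exists>i\<in>U. (i, k) \<in> (hasse_edges_on (order_hull U))\<^sup>*" if k: "k \<in> order_hull U" for k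
  proof -
    obtain i where "i \<in> U" "i \<le> k" using k by (auto simp: order_hull_def)
    then show ?thesis
      using convex_interval_connected[OF order_convex_order_hull _ k, of i] subset_order_hull by blast
  qed
  then show ?thesis
    unfolding hasse_connected_def using assms by (meson hasse_rtrancl_commute rtrancl_trans)
qed

text \<open>A path can be shortened to at most \<open>card R\<close> edges. The bound is one-sided
  because edges between pipes will control differences in one direction only.\<close>

lemma rtrancl_diff_le:
  fixes f :: "'a \<Rightarrow> real"
  assumes "finite R" "(a, b) \<in> R\<^sup>*" "\<And>x y. (x, y) \<in> R \<Longrightarrow> f x - f y \<le> d" "0 \<le> d"
  shows "f a - f b \<le> real (card R) * d"
proof -
  obtain n where n: "n \<le> card R" "(a, b) \<in> R ^^ n"
    using assms(1,2) by (auto simp: rtrancl_finite_eq_relpow)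
  have "f a - f b \<le> real n * d"
    using n(2)
  proof (induction n arbitrary: b)
    case (Suc n)
    then obtain c where "(a, c) \<in> R ^^ n" "(c, b) \<in> R" by auto
    then show ?case using Suc.IH[of c] assms(3)[of c b] by (simp add: algebra_simps)
  qed simp
  also have "\<dots> \<le> real (card R) * d" using n(1) assms(4) by (intro mult_right_mono) auto
  finally show ?thesis .
qed

text \<open>The right-hand sides of the facet inequalities of the simple polytope: they only have to grow
  fast enough with the size of the pipe.\<close>

definition growth :: "nat \<Rightarrow> real" where
  "growth n = 16 * 4 ^ n * real n ^ 6"

definition height :: "'p::finite set \<Rightarrow> real" where
  "height S = growth CARD('p) ^ card S"

definition feasible :: "real ^ 'p::{finite,order} \<Rightarrow> bool" where
  "feasible x \<longleftrightarrow>
     (\<forall>\<tau>. pipe \<tau> \<and> 1 < card \<tau> \<longrightarrow> height \<tau> \<le> slope_vec \<tau> \<bullet> x) \<and>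
     slope_vec UNIV \<bullet> x = height (UNIV :: 'p set)"

text \<open>Only proper pipes are listed, since the whole poset is tight at every feasible
  point.\<close>

definition tight_pipes :: "real ^ 'p::{finite,order} \<Rightarrow> 'p set set" where
  "tight_pipes x = {\<tau>. proper_pipe \<tau> \<and> slope_vec \<tau> \<bullet> x = height \<tau>}"

lemma growth_ge_1: "1 \<le> n \<Longrightarrow> 1 \<le> growth n"
  unfolding growth_def by (intro mult_ge1_I) auto

lemma growth_pos: "0 < growth CARD('p::finite)"
  using growth_ge_1[of "CARD('p)"] by simp

lemma height_pos: "0 < height (S :: 'p::finite set)"
  by (simp add: height_def growth_pos)

lemma height_mono: "card S \<le> card T \<Longrightarrow> height (S :: 'p::finite set) \<le> height (T :: 'p set)"
  unfolding height_def using growth_ge_1[of "CARD('p)"] by (intro power_increasing) auto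

lemma height_growth:
  fixes S T :: "'p::finite set"
  assumes "card S < card T"
  shows "growth CARD('p) * height S \<le> height T"
proof -
  have "growth CARD('p) ^ Suc (card S) \<le> growth CARD('p) ^ card T"
    using assms growth_ge_1[of "CARD('p)"] by (intro power_increasing) (auto simp: Suc_leI)
  then show ?thesis by (simp add: height_def)
qed

section \<open>Monotonicity and spread of feasible points\<close>

lemma pipe_cover:
  fixes i j :: "'p::{finite,order}"
  assumes "covered_by i j"
  shows "pipe {i, j}" "card {i, j} = 2" "covers_in {i, j} = {(i, j)}"
proof -
  show "card {i, j} = 2" using assms by (auto simp: covered_by_def)
  show "covers_in {i, j} = {(i, j)}" using assms by (auto simp: covers_in_def covered_by_def)
  have "(i, j) \<in> hasse_edges_on {i, j}" "(j, i) \<in> hasse_edges_on {i, j}"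
    using assms by (auto simp: hasse_edges_on_def)
  moreover have "order_convex {i, j}"
    using assms by (auto simp: order_convex_def covered_by_def)
  ultimately show "pipe {i, j}" by (auto simp: pipe_def hasse_connected_def)
qed

text \<open>Every cover is a two-element pipe of positive height, so \<open>x\<close> grows along
  it.\<close>

lemma feasible_mono:
  fixes x :: "real ^ 'p::{finite,order}"
  assumes "feasible x" "i \<le> j"
  shows "x $ i \<le> x $ j"
proof -
  have cov: "x $ k \<le> x $ l" if "covered_by k l" for k l
  proof -
    have "height {k, l} \<le> slope_vec {k, l} \<bullet> x"
      using assms(1) pipe_cover(1,2)[OF that] by (auto simp: feasible_def)
    then show ?thesis
      using height_pos[of "{k, l}"] by (simp add: slope_vec_inner pipe_cover(3)[OF that])
  qed
  have "(i, j) \<in> (covers_in UNIV)\<^sup>*"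
    using assms(2) by (intro convex_interval_path) (auto simp: order_convex_def)
  then show ?thesis
    by induction (auto simp: covers_in_def intro: order_trans cov)
qed

text \<open>By monotonicity no cover decreases \<open>x\<close>, so each increment is at most their
  sum \<open>slope_vec \<tau> \<bullet> x\<close>; a path in \<tau> needs at most
  \<open>CARD('p)\<close> squared edges.\<close>

lemma feasible_diff_le:
  fixes x :: "real ^ 'p::{finite,order}"
  assumes x: "feasible x" and "hasse_connected \<tau>" "i \<in> \<tau>" "j \<in> \<tau>"
  shows "x $ i - x $ j \<le> real CARD('p) ^ 2 * (slope_vec \<tau> \<bullet> x)"
proof -
  have nn: "0 \<le> x $ l - x $ k" if "(k, l) \<in> covers_in \<tau>" for k l
    using that feasible_mono[OF x] by (auto simp: covers_in_def covered_by_def)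
  have pos: "0 \<le> slope_vec \<tau> \<bullet> x"
    unfolding slope_vec_inner using nn by (intro sum_nonneg) auto
  have c: "x $ l - x $ k \<le> slope_vec \<tau> \<bullet> x" if "(k, l) \<in> covers_in \<tau>" for k l
    unfolding slope_vec_inner
    using member_le_sum[of "(k, l)" "covers_in \<tau>" "\<lambda>(i, j). x $ j - x $ i"] that nn by auto
  have e: "x $ k - x $ l \<le> slope_vec \<tau> \<bullet> x" if "(k, l) \<in> hasse_edges_on \<tau>" for k l
  proof (cases "covered_by k l")
    case True
    then show ?thesis using feasible_mono[OF x, of k l] pos by (force simp: covered_by_def)
  next
    case False
    then show ?thesis using that c[of l k] by (auto simp: hasse_edges_on_def covers_in_def)
  qed
  have "x $ i - x $ j \<le> real (card (hasse_edges_on \<tau>)) * (slope_vec \<tau> \<bullet> x)"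
    using assms(2-4) e pos by (intro rtrancl_diff_le) (auto simp: hasse_connected_def)
  also have "\<dots> \<le> real (CARD('p)\<^sup>2) * (slope_vec \<tau> \<bullet> x)"
    using pos card_rel_le by (intro mult_right_mono of_nat_mono)
  finally show ?thesis by simp
qed

text \<open>If tight pipes met or fed into each other cyclically, all coordinates on their union, hence on
  its order hull, would be too close for the inequality of that hull.\<close>

lemma feasible_no_cluster:
  fixes x :: "real ^ 'p::{finite,order}" and \<tau> U :: "'p set"
  assumes x: "feasible x" and \<tau>: "card \<tau> < card (order_hull U)" "\<tau> \<noteq> {}"
    and conn: "\<And>i j. i \<in> U \<Longrightarrow> j \<in> U \<Longrightarrow> (i, j) \<in> (hasse_edges_on (order_hull U))\<^sup>*"
    and close: "\<And>i j. i \<in> U \<Longrightarrow> j \<in> U \<Longrightarrow> x $ i - x $ j \<le> 8 * 4 ^ CARD('p) * real CARD('p) ^ 2 * height \<tau>"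
  shows False
proof -
  let ?n = "real CARD('p)" and ?d = "8 * 4 ^ CARD('p) * real CARD('p) ^ 2 * height \<tau>"
  have n: "1 \<le> ?n" by (simp add: Suc_leI)
  have c: "1 < card (order_hull U)"
    using \<tau> by (metis card_gt_0_iff finite less_one linorder_neqE_nat not_less_iff_gr_or_eq order_less_trans)
  then have "order_hull U \<noteq> {}" by auto
  then have "pipe (order_hull U)"
    using hasse_connected_order_hull[OF conn] order_convex_order_hull by (auto simp: pipe_def)
  then have "height (order_hull U) \<le> slope_vec (order_hull U) \<bullet> x"
    using x c by (auto simp: feasible_def)
  also have "\<dots> \<le> ?n ^ 2 * ?d"
  proof (rule slope_vec_le)
    \<comment> \<open>A cover in the hull is squeezed between two points of \<open>U\<close>, so
      monotonicity bounds its increment.\<close>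
    fix i j assume "(i, j) \<in> covers_in (order_hull U)"
    then obtain s t where "s \<in> U" "t \<in> U" "s \<le> i" "j \<le> t"
      by (auto simp: covers_in_def order_hull_def)
    then show "x $ j - x $ i \<le> ?d"
      using close[of t s] feasible_mono[OF x, of s i] feasible_mono[OF x, of j t] by linarith
  next
    show "0 \<le> ?d" using height_pos[of \<tau>] by simp
  qed
  also have "\<dots> = 8 * 4 ^ CARD('p) * ?n ^ 4 * height \<tau>"
    by (simp add: power2_eq_square power4_eq_xxxx)
  \<comment> \<open>\<open>growth\<close> has 16 and a sixth power against the 8 and fourth power
    here, and the hull, being larger than \<tau>, gains a full factor \<open>growth\<close>.\<close>
  also have "\<dots> \<le> 8 * 4 ^ CARD('p) * ?n ^ 6 * height \<tau>"
    using n height_pos[of \<tau>] by (intro mult_right_mono mult_left_mono power_increasing) auto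
  also have "\<dots> < growth CARD('p) * height \<tau>"
    using n height_pos[of \<tau>] unfolding growth_def by (intro mult_strict_right_mono) auto
  also have "\<dots> \<le> height (order_hull U)"
    using \<tau>(1) by (rule height_growth)
  finally show False by simp
qed

section \<open>Tight pipes form a piping\<close>

lemma tight_pipes_diff_le:
  fixes x :: "real ^ 'p::{finite,order}"
  assumes "feasible x" "\<tau> \<in> tight_pipes x" "i \<in> \<tau>" "j \<in> \<tau>"
  shows "x $ i - x $ j \<le> real CARD('p) ^ 2 * height \<tau>"
  using feasible_diff_le[OF assms(1) _ assms(3,4)] assms(2)
  by (auto simp: tight_pipes_def proper_pipe_def pipe_def)

lemma hasse_connected_within:
  assumes "hasse_connected \<tau>" "\<tau> \<subseteq> S" "i \<in> \<tau>" "j \<in> \<tau>"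
  shows "(i, j) \<in> (hasse_edges_on S)\<^sup>*"
  using assms rtrancl_mono[OF hasse_edges_on_mono[OF assms(2)]] by (auto simp: hasse_connected_def)

text \<open>The larger pipe sets the scale: if \<sigma> left \<tau>, the hull of the union would be
  strictly larger than \<tau>, although all values on the union are close to the one at the common
  point \<open>m\<close>.\<close>

lemma tight_pipes_nested_aux:
  fixes x :: "real ^ 'p::{finite,order}"
  assumes x: "feasible x" and \<sigma>: "\<sigma> \<in> tight_pipes x" and \<tau>: "\<tau> \<in> tight_pipes x"
    and le: "card \<sigma> \<le> card \<tau>" and m: "m \<in> \<sigma>" "m \<in> \<tau>"
  shows "\<sigma> \<subseteq> \<tau>"
proof (rule ccontr)
  assume "\<not> \<sigma> \<subseteq> \<tau>"
  let ?U = "\<sigma> \<union> \<tau>"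
  have sub: "?U \<subseteq> order_hull ?U" by (rule subset_order_hull)
  have "\<tau> \<subset> order_hull ?U" using sub \<open>\<not> \<sigma> \<subseteq> \<tau>\<close> by blast
  then have c: "card \<tau> < card (order_hull ?U)" by (simp add: psubset_card_mono)
  have hc: "hasse_connected \<sigma>" "hasse_connected \<tau>"
    using \<sigma> \<tau> by (auto simp: tight_pipes_def proper_pipe_def pipe_def)
  have conn: "(i, m) \<in> (hasse_edges_on (order_hull ?U))\<^sup>*" if "i \<in> ?U" for i
    using that hasse_connected_within[OF hc(1), of "order_hull ?U" i m]
      hasse_connected_within[OF hc(2), of "order_hull ?U" i m] sub m by auto
  have hle: "height \<sigma> \<le> height \<tau>" using le by (rule height_mono)
  have h2: "real CARD('p) ^ 2 * height \<sigma> \<le> real CARD('p) ^ 2 * height \<tau>"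
    using hle by (intro mult_left_mono) auto
  have d: "x $ i - x $ m \<le> real CARD('p) ^ 2 * height \<tau>"
    "x $ m - x $ i \<le> real CARD('p) ^ 2 * height \<tau>" if "i \<in> ?U" for i
    using that m
    by (auto intro: order_trans[OF tight_pipes_diff_le[OF x \<sigma>] h2] tight_pipes_diff_le[OF x \<tau>])
  show False
  proof (rule feasible_no_cluster[OF x c])
    show "\<tau> \<noteq> {}" using m by auto
    fix i j assume ij: "i \<in> ?U" "j \<in> ?U"
    show "(i, j) \<in> (hasse_edges_on (order_hull ?U))\<^sup>*"
      using conn[OF ij(1)] conn[OF ij(2)] by (meson hasse_rtrancl_commute rtrancl_trans)
    \<comment> \<open>Only a factor 2 is needed here; the bound of
      \<open>feasible_no_cluster\<close> is sized for cycles of pipes.\<close>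
    have "1 \<le> (4::real) ^ CARD('p)" by simp
    then have "1 * (real CARD('p) ^ 2 * height \<tau>) \<le> 4 ^ CARD('p) * (real CARD('p) ^ 2 * height \<tau>)"
      using height_pos[of \<tau>] by (intro mult_right_mono) auto
    moreover have "0 \<le> real CARD('p) ^ 2 * height \<tau>" using height_pos[of \<tau>] by simp
    moreover have "x $ i - x $ j \<le> 2 * (real CARD('p) ^ 2 * height \<tau>)"
      using d(1)[OF ij(1)] d(2)[OF ij(2)] by linarith
    ultimately show "x $ i - x $ j \<le> 8 * 4 ^ CARD('p) * real CARD('p) ^ 2 * height \<tau>"
      by (simp only: mult.assoc)
  qed
qed

lemma tight_pipes_nested:
  fixes x :: "real ^ 'p::{finite,order}"
  assumes "feasible x" "\<sigma> \<in> tight_pipes x" "\<tau> \<in> tight_pipes x"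
  shows "nested \<sigma> \<tau> \<or> disjnt \<sigma> \<tau>"
  using tight_pipes_nested_aux[OF assms(1)] assms(2,3)
  by (metis disjnt_iff nested_def nle_le)

text \<open>The argument treats a whole strong component of the digraph, whose largest pipe sets the
  scale. Edges bound differences in one direction only; strong connectivity supplies the
  other.\<close>

lemma tight_pipes_acyclic:
  fixes x :: "real ^ 'p::{finite,order}"
  assumes x: "feasible x"
  shows "acyclic (piping_digraph (tight_pipes x))"
proof (rule ccontr)
  define D where "D = piping_digraph (tight_pipes x)"
  define C where "C = {\<tau>. (\<tau>, \<tau>) \<in> D\<^sup>+}"
  assume "\<not> acyclic (piping_digraph (tight_pipes x))"
  then have "C \<noteq> {}" by (auto simp: acyclic_def D_def C_def)
  then obtain \<tau> where \<tau>: "\<tau> \<in> C" "\<And>\<sigma>. \<sigma> \<in> C \<Longrightarrow> card \<sigma> \<le> card \<tau>"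
  proof -
    have "Max (card ` C) \<in> card ` C" using \<open>C \<noteq> {}\<close> by (intro Max_in) auto
    then obtain \<rho> where "\<rho> \<in> C" "card \<rho> = Max (card ` C)" by auto
    then show ?thesis using that[of \<rho>] by simp
  qed
  \<comment> \<open>\<open>S\<close> is the strong component of \<tau>, and \<open>R\<close> keeps
    paths inside it, where no height exceeds that of \<tau>.\<close>
  define S where "S = {\<sigma>. (\<tau>, \<sigma>) \<in> D\<^sup>* \<and> (\<sigma>, \<tau>) \<in> D\<^sup>*}"
  define R where "R = D \<inter> S \<times> S"
  let ?U = "\<Union>S"
  let ?H = "(hasse_edges_on (order_hull ?U))\<^sup>*"
  let ?d = "real CARD('p) ^ 2 * height \<tau>"
  have \<tau>S: "\<tau> \<in> S" by (simp add: S_def)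
  have SC: "\<sigma> \<in> C" if "\<sigma> \<in> S" for \<sigma>
    using that \<tau>(1) unfolding S_def C_def
    by (metis (mono_tags, lifting) mem_Collect_eq rtrancl_trancl_trancl trancl_rtrancl_trancl)
  have reach: "(\<tau>, \<sigma>) \<in> R\<^sup>*" if "\<sigma> \<in> S" for \<sigma>
  proof -
    have "(\<sigma>, \<tau>) \<in> D\<^sup>* \<Longrightarrow> (\<tau>, \<sigma>) \<in> R\<^sup>*" if "(\<tau>, \<sigma>) \<in> D\<^sup>*"
      using that
    proof induction
      case (step y z)
      then have "(y, \<tau>) \<in> D\<^sup>*" "(y, z) \<in> R"
        by (auto simp: R_def S_def intro: converse_rtrancl_into_rtrancl rtrancl_into_rtrancl)
      then show ?case using step.IH by (meson rtrancl_into_rtrancl)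
    qed simp
    then show ?thesis using that by (simp add: S_def)
  qed
  have backward: "(\<sigma>, \<tau>) \<in> R\<^sup>*" if "\<sigma> \<in> S" for \<sigma>
  proof -
    have "(\<tau>, \<sigma>) \<in> D\<^sup>* \<Longrightarrow> (\<sigma>, \<tau>) \<in> R\<^sup>*" if "(\<sigma>, \<tau>) \<in> D\<^sup>*"
      using that
    proof (induction rule: converse_rtrancl_induct)
      case (step y z)
      then have "(\<tau>, z) \<in> D\<^sup>*" "(y, z) \<in> R"
        by (auto simp: R_def S_def intro: converse_rtrancl_into_rtrancl rtrancl_into_rtrancl)
      then show ?case using step.IH by (meson converse_rtrancl_into_rtrancl)
    qed simp
    then show ?thesis using that by (simp add: S_def)
  qed
  have tp: "\<sigma> \<in> tight_pipes x" if "\<sigma> \<in> S" for \<sigma>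
    using SC[OF that] unfolding C_def D_def by (auto dest!: tranclD simp: piping_digraph_def)
  have ne: "\<sigma> \<noteq> {}" and hc: "hasse_connected \<sigma>" if "\<sigma> \<in> S" for \<sigma>
    using tp[OF that] by (auto simp: tight_pipes_def proper_pipe_def pipe_def)
  have dS: "x $ i - x $ j \<le> ?d" if "\<sigma> \<in> S" "i \<in> \<sigma>" "j \<in> \<sigma>" for \<sigma> i j
  proof -
    have "height \<sigma> \<le> height \<tau>" using \<tau>(2)[OF SC[OF that(1)]] by (rule height_mono)
    then have "real CARD('p) ^ 2 * height \<sigma> \<le> ?d" by (intro mult_left_mono) auto
    then show ?thesis using tight_pipes_diff_le[OF x tp[OF that(1)] that(2,3)] by linarith
  qed
  define f where "f \<sigma> = (SOME i. i \<in> \<sigma>)" for \<sigma> :: "'p set"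
  have f: "f \<sigma> \<in> \<sigma>" if "\<sigma> \<in> S" for \<sigma>
    unfolding f_def using ne[OF that] by (simp add: some_in_eq)
  have d0: "0 \<le> ?d" using height_pos[of \<tau>] by simp
  \<comment> \<open>From the base point of \<sigma> to \<open>i\<close>, then to \<open>j\<close> at
    no cost by monotonicity, then to the base point of \<rho>.\<close>
  have fR: "x $ f \<sigma> - x $ f \<rho> \<le> 2 * ?d" if r: "(\<sigma>, \<rho>) \<in> R" for \<sigma> \<rho>
  proof -
    obtain i j where ij: "i \<in> \<sigma>" "j \<in> \<rho>" "i < j" and S: "\<sigma> \<in> S" "\<rho> \<in> S"
      using r by (auto simp: R_def D_def piping_digraph_def)
    then show ?thesis
      using dS[OF S(1) f[OF S(1)] ij(1)] dS[OF S(2) ij(2) f[OF S(2)]]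
        feasible_mono[OF x less_imp_le[OF ij(3)]] by linarith
  qed
  \<comment> \<open>\<open>R\<close> relates subsets of the poset, which explains the factor
    \<open>4 ^ CARD('p)\<close> in \<open>feasible_no_cluster\<close>.\<close>
  have "card R \<le> CARD('p set)\<^sup>2" by (rule card_rel_le)
  also have "CARD('p set) = 2 ^ CARD('p)" by (simp add: card_set)
  also have "((2::nat) ^ CARD('p))\<^sup>2 = 4 ^ CARD('p)" by (simp add: power2_eq_square flip: power_mult_distrib)
  finally have "real (card R) \<le> real (4 ^ CARD('p))" by (rule of_nat_mono)
  then have cR: "real (card R) * (2 * ?d) \<le> 4 ^ CARD('p) * (2 * ?d)"
    using d0 by (intro mult_right_mono) auto
  have fS: "x $ f \<sigma> - x $ f \<rho> \<le> 4 ^ CARD('p) * (2 * ?d)" if "(\<sigma>, \<rho>) \<in> R\<^sup>*" for \<sigma> \<rho>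
  proof -
    have "x $ f \<sigma> - x $ f \<rho> \<le> real (card R) * (2 * ?d)"
      using d0 fR by (intro rtrancl_diff_le[OF _ that]) auto
    then show ?thesis using cR by linarith
  qed
  have sub: "\<sigma> \<subseteq> order_hull ?U" if "\<sigma> \<in> S" for \<sigma>
    using that subset_order_hull[of ?U] by blast
  have connR: "(f \<tau>, f \<sigma>) \<in> ?H" if "(\<tau>, \<sigma>) \<in> R\<^sup>*" for \<sigma>
    using that
  proof induction
    case (step \<sigma> \<rho>)
    obtain i j where ij: "i \<in> \<sigma>" "j \<in> \<rho>" "i < j" and S: "\<sigma> \<in> S" "\<rho> \<in> S"
      using step(2) by (auto simp: R_def D_def piping_digraph_def)
    have "(f \<sigma>, i) \<in> ?H" "(j, f \<rho>) \<in> ?H"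
      using hasse_connected_within[OF hc[OF S(1)] sub[OF S(1)] f[OF S(1)] ij(1)]
        hasse_connected_within[OF hc[OF S(2)] sub[OF S(2)] ij(2) f[OF S(2)]] by auto
    moreover have "(i, j) \<in> ?H"
      using ij sub[OF S(1)] sub[OF S(2)]
      by (intro convex_interval_connected order_convex_order_hull) auto
    ultimately show ?case using step.IH by (meson rtrancl_trans)
  qed simp
  \<comment> \<open>The next pipe on the cycle is disjoint from \<tau>, so the hull is strictly
    larger than \<tau>.\<close>
  obtain \<sigma> where \<sigma>: "(\<tau>, \<sigma>) \<in> D" "(\<sigma>, \<tau>) \<in> D\<^sup>*"
    using \<tau>(1) unfolding C_def by (auto dest: tranclD)
  then have \<sigma>S: "\<sigma> \<in> S" by (auto simp: S_def)
  have "\<sigma> \<inter> \<tau> = {}" using \<sigma>(1) by (auto simp: D_def piping_digraph_def)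
  then have "\<tau> \<subset> order_hull ?U"
    using sub[OF \<sigma>S] sub[OF \<tau>S] ne[OF \<sigma>S] by blast
  then have c: "card \<tau> < card (order_hull ?U)" by (simp add: psubset_card_mono)
  show False
  proof (rule feasible_no_cluster[OF x c ne[OF \<tau>S]])
    fix i j assume ij: "i \<in> ?U" "j \<in> ?U"
    then obtain \<rho> \<rho>' where \<rho>: "\<rho> \<in> S" "i \<in> \<rho>" "\<rho>' \<in> S" "j \<in> \<rho>'" by blast
    have "(f \<tau>, i) \<in> ?H" "(f \<tau>, j) \<in> ?H"
      using connR[OF reach[OF \<rho>(1)]] connR[OF reach[OF \<rho>(3)]]
        hasse_connected_within[OF hc[OF \<rho>(1)] sub[OF \<rho>(1)] f[OF \<rho>(1)] \<rho>(2)]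
        hasse_connected_within[OF hc[OF \<rho>(3)] sub[OF \<rho>(3)] f[OF \<rho>(3)] \<rho>(4)]
      by (auto intro: rtrancl_trans)
    then show "(i, j) \<in> ?H" by (meson hasse_rtrancl_commute rtrancl_trans)
    have "1 \<le> (4::real) ^ CARD('p)" by simp
    then have "1 * ?d \<le> 4 ^ CARD('p) * ?d"
      using d0 by (intro mult_right_mono)
    \<comment> \<open>Two moves inside pipes cost \<open>2 * ?d\<close>; the base point paths to and
      from \<tau> cost \<open>2 * 4 ^ CARD('p) * ?d\<close> each.\<close>
    moreover have "x $ i - x $ j \<le> 2 * ?d + 4 * (4 ^ CARD('p) * ?d)"
      using dS[OF \<rho>(1,2) f[OF \<rho>(1)]] dS[OF \<rho>(3) f[OF \<rho>(3)] \<rho>(4)]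
        fS[OF backward[OF \<rho>(1)]] fS[OF reach[OF \<rho>(3)]] by linarith
    moreover have "8 * 4 ^ CARD('p) * real CARD('p) ^ 2 * height \<tau> = 8 * (4 ^ CARD('p) * ?d)"
      by (simp only: mult.assoc)
    ultimately show "x $ i - x $ j \<le> 8 * 4 ^ CARD('p) * real CARD('p) ^ 2 * height \<tau>"
      using d0 by linarith
  qed
qed

lemma tight_pipes_proper_piping:
  assumes "feasible x"
  shows "proper_piping (tight_pipes x)"
  using tight_pipes_nested[OF assms] tight_pipes_acyclic[OF assms]
  by (auto simp: proper_piping_def piping_def tight_pipes_def proper_pipe_def)

section \<open>Level functions of a piping\<close>

definition children :: "'p set set \<Rightarrow> 'p set \<Rightarrow> 'p set set" where
  "children T \<tau> = {\<sigma> \<in> T. \<sigma> \<subset> \<tau> \<and> (\<forall>\<rho>\<in>T. \<sigma> \<subseteq> \<rho> \<and> \<rho> \<subset> \<tau> \<longrightarrow> \<rho> = \<sigma>)}"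

text \<open>Used through its reflexive transitive closure, the preorder generated by the order on
  \<tau> and the identification of all points of each child.\<close>

definition block_le :: "'p::order set set \<Rightarrow> 'p set \<Rightarrow> ('p \<times> 'p) set" where
  "block_le T \<tau> = {(i, j). i \<in> \<tau> \<and> j \<in> \<tau> \<and> (i \<le> j \<or> (\<exists>\<sigma>\<in>children T \<tau>. i \<in> \<sigma> \<and> j \<in> \<sigma>))}"

text \<open>The number of elements of \<open>\<tau>\<close> below \<open>j\<close> after each child of \<open>\<tau>\<close> has been contracted to a
  point. This is the function \<open>g\<^sub>\<tau>\<close>.\<close>

definition level :: "'p::{finite,order} set set \<Rightarrow> 'p set \<Rightarrow> real ^ 'p::{finite,order}" where
  "level T \<tau> = (\<chi> j. if j \<in> \<tau> then real (card {i. (i, j) \<in> (block_le T \<tau>)\<^sup>*}) else 0)"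

text \<open>The whole poset meets every pipe, so it adds no edge to the digraph. It will serve as
  the root of the piping.\<close>

lemma piping_insert_UNIV:
  fixes T :: "'p::order set set"
  assumes T: "piping T" and "pipe (UNIV :: 'p set)"
  shows "piping (insert UNIV T)"
proof -
  have "piping_digraph (insert UNIV T) = piping_digraph T"
    using T by (auto simp: piping_digraph_def piping_def pipe_def)
  then show ?thesis
    using assms by (auto simp: piping_def nested_def)
qed

section \<open>Members of a piping and their children\<close>

lemma child_above:
  fixes T :: "'p::finite set set"
  assumes "\<sigma> \<in> T" "\<sigma> \<subset> \<tau>"
  obtains A where "A \<in> children T \<tau>" "\<sigma> \<subseteq> A"
proof -
  obtain A where "A \<in> {\<rho> \<in> T. \<rho> \<subset> \<tau>}" "\<sigma> \<subseteq> A" "\<forall>\<rho>\<in>{\<rho> \<in> T. \<rho> \<subset> \<tau>}. A \<subseteq> \<rho> \<longrightarrow> A = \<rho>"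
    using finite_has_maximal2[of "{\<rho> \<in> T. \<rho> \<subset> \<tau>}" \<sigma>] assms by auto
  then show ?thesis using that[of A] by (auto simp: children_def)
qed

lemma children_subset: "A \<in> children T \<tau> \<Longrightarrow> A \<in> T"
  by (simp add: children_def)

lemma piping_pipe: "piping T \<Longrightarrow> \<tau> \<in> T \<Longrightarrow> pipe \<tau>"
  by (simp add: piping_def)

lemma piping_nested:
  assumes "piping T" "\<sigma> \<in> T" "\<tau> \<in> T"
  shows "\<sigma> \<subseteq> \<tau> \<or> \<tau> \<subseteq> \<sigma> \<or> \<sigma> \<inter> \<tau> = {}"
proof -
  have "\<forall>\<sigma>\<in>T. \<forall>\<tau>\<in>T. nested \<sigma> \<tau> \<or> disjnt \<sigma> \<tau>"
    using assms(1) unfolding piping_def by (elim conjE)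
  then have "nested \<sigma> \<tau> \<or> disjnt \<sigma> \<tau>" using assms(2,3) by simp
  then show ?thesis by (auto simp: nested_def disjnt_def)
qed

lemma children_disjoint:
  assumes "piping T" "A \<in> children T \<tau>" "B \<in> children T \<tau>"
  shows "A = B \<or> A \<inter> B = {}"
proof -
  have "A = B" if "A \<subseteq> B" using assms(2,3) that by (simp add: children_def)
  moreover have "A = B" if "B \<subseteq> A" using assms(2,3) that by (simp add: children_def)
  ultimately show ?thesis
    using piping_nested[OF assms(1) assms(2,3)[THEN children_subset]] by argo
qed

text \<open>A normal form for chains: only the first child \<open>A\<close> and the last child
  \<open>B\<close> used are kept, joined by a path in the digraph. A change of child is an edge
  because distinct children are disjoint.\<close>

lemma block_le_rtrancl_cases:
  assumes T: "piping T" and "(p, q) \<in> (block_le T \<tau>)\<^sup>*"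
  shows "p \<le> q \<or> (\<exists>A\<in>children T \<tau>. p \<in> A \<and> q \<in> A) \<or>
    (\<exists>A\<in>children T \<tau>. \<exists>B\<in>children T \<tau>. (A, B) \<in> (piping_digraph T)\<^sup>* \<and>
       (\<exists>a\<in>A. p \<le> a) \<and> (\<exists>b\<in>B. b \<le> q))"
  using assms(2)
proof induction
  case (step q r)
  let ?D = "piping_digraph T"
  consider (le) "q \<le> r" | (block) C where "C \<in> children T \<tau>" "q \<in> C" "r \<in> C"
    using step(2) by (auto simp: block_le_def)
  then show ?case
  proof cases
    case le
    then show ?thesis using step.IH by (meson order_refl order_trans rtrancl.rtrancl_refl)
  next
    case C: block
    from step.IH consider (1) "p \<le> q" | (2) A where "A \<in> children T \<tau>" "p \<in> A" "q \<in> A"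
      | (3) A B a b where "A \<in> children T \<tau>" "B \<in> children T \<tau>" "(A, B) \<in> ?D\<^sup>*"
          "a \<in> A" "p \<le> a" "b \<in> B" "b \<le> q"
      by blast
    then show ?thesis
    proof cases
      case 1
      then show ?thesis using C by (meson order_refl rtrancl.rtrancl_refl)
    next
      case 2
      then have "A = C" using children_disjoint[OF T 2(1) C(1)] C(2) 2(3) by blast
      then show ?thesis using 2 C by blast
    next
      case 3
      have "(A, C) \<in> ?D\<^sup>*"
      proof (cases "B = C")
        case False
        then have "B \<inter> C = {}" using children_disjoint[OF T 3(2) C(1)] by blast
        then have "b < q" using 3(6,7) C(2) by (auto simp: order_le_less)
        moreover have "B \<in> T" "C \<in> T" using 3(2) C(1) by (auto dest: children_subset)
        ultimately have "(B, C) \<in> ?D"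
          using 3(6) C(2) \<open>B \<inter> C = {}\<close> unfolding piping_digraph_def by blast
        then show ?thesis using 3(3) by simp
      qed (use 3 in simp)
      then show ?thesis using 3 C by blast
    qed
  qed
qed simp

text \<open>Acyclicity of the piping makes \<^const>\<open>block_le\<close> antisymmetric up to blocks.\<close>

lemma block_le_antisym:
  fixes T :: "'p::{finite,order} set set"
  assumes T: "piping T" and "i < j" "(j, i) \<in> (block_le T \<tau>)\<^sup>*"
  shows "\<exists>A\<in>children T \<tau>. i \<in> A \<and> j \<in> A"
proof -
  let ?D = "piping_digraph T"
  show ?thesis
    using block_le_rtrancl_cases[OF T assms(3)]
  proof (elim disjE bexE conjE)
    fix A B a b
    assume 3: "A \<in> children T \<tau>" "B \<in> children T \<tau>" "(A, B) \<in> ?D\<^sup>*"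
      "a \<in> A" "j \<le> a" "b \<in> B" "b \<le> i"
    \<comment> \<open>Here \<open>b \<le> i < j \<le> a\<close>. If the two children agree,
      convexity captures \<open>i\<close> and \<open>j\<close>; otherwise the edge from
      \<open>B\<close> to \<open>A\<close> closes a cycle.\<close>
    have ba: "b < a" using 3 assms(2) by (meson order.strict_trans1 order.strict_trans2)
    show ?thesis
    proof (cases "A = B")
      case True
      have "order_convex A" using piping_pipe[OF T children_subset[OF 3(1)]] by (simp add: pipe_def)
      then have "i \<in> A" "j \<in> A"
        using 3 True assms(2) unfolding order_convex_def
        by (metis order_le_less order.strict_trans1 order.strict_trans2)+
      then show ?thesis using 3 by blast
    next
      case False
      then have "A \<inter> B = {}" using children_disjoint[OF T 3(1,2)] by blast
      moreover have "A \<in> T" "B \<in> T" using 3(1,2) by (auto dest: children_subset)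
      ultimately have "(B, A) \<in> ?D" using 3(4,6) ba unfolding piping_digraph_def by blast
      then have "(B, B) \<in> ?D\<^sup>+" using 3(3) by (meson rtrancl_into_trancl2)
      then show ?thesis using T by (auto simp: piping_def acyclic_def)
    qed
  qed (use assms(2) in auto)
qed

section \<open>Values of the linear forms on level functions\<close>

lemma level_outside: "j \<notin> \<tau> \<Longrightarrow> level T \<tau> $ j = 0"
  by (simp add: level_def)

lemma level_bounds: "0 \<le> level T \<tau> $ j \<and> level T \<tau> $ j \<le> real CARD('p)"
  for T :: "'p::{finite,order} set set"
  by (simp add: level_def card_mono)

lemma level_mono:
  assumes "(i, j) \<in> block_le T \<tau>"
  shows "level T \<tau> $ i \<le> level T \<tau> $ j"
proof -
  have "{k. (k, i) \<in> (block_le T \<tau>)\<^sup>*} \<subseteq> {k. (k, j) \<in> (block_le T \<tau>)\<^sup>*}"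
    using assms by (auto intro: rtrancl_into_rtrancl)
  then show ?thesis using assms by (simp add: level_def block_le_def card_mono)
qed

text \<open>The count at \<open>j\<close> includes \<open>j\<close> itself, which is not counted at
  \<open>i\<close>: otherwise antisymmetry would put both points in one child.\<close>

lemma level_strict:
  assumes T: "piping T" and "i \<in> \<tau>" "j \<in> \<tau>" "i < j" "\<not> (\<exists>A\<in>children T \<tau>. i \<in> A \<and> j \<in> A)"
  shows "level T \<tau> $ i + 1 \<le> level T \<tau> $ j"
proof -
  have "(i, j) \<in> block_le T \<tau>"
    using assms(2,3) less_imp_le[OF assms(4)] by (simp add: block_le_def)
  then have "{k. (k, i) \<in> (block_le T \<tau>)\<^sup>*} \<subseteq> {k. (k, j) \<in> (block_le T \<tau>)\<^sup>*}"
    by (auto intro: rtrancl_into_rtrancl)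
  moreover have "j \<notin> {k. (k, i) \<in> (block_le T \<tau>)\<^sup>*}"
    using block_le_antisym[OF T assms(4)] assms(5) by blast
  ultimately have "{k. (k, i) \<in> (block_le T \<tau>)\<^sup>*} \<subset> {k. (k, j) \<in> (block_le T \<tau>)\<^sup>*}" by auto
  then have "card {k. (k, i) \<in> (block_le T \<tau>)\<^sup>*} < card {k. (k, j) \<in> (block_le T \<tau>)\<^sup>*}"
    by (simp add: psubset_card_mono)
  then show ?thesis using assms(2,3) by (simp add: level_def)
qed

text \<open>A member not containing \<tau> either lies inside a child of \<tau> or is disjoint from
  \<tau>.\<close>

lemma level_const:
  assumes T: "piping T" and "\<sigma> \<in> T" "\<tau> \<in> T" "\<not> \<tau> \<subseteq> \<sigma>" "i \<in> \<sigma>" "j \<in> \<sigma>"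
  shows "level T \<tau> $ i = level T \<tau> $ j"
proof (cases "\<sigma> \<subset> \<tau>")
  case True
  then obtain A where "A \<in> children T \<tau>" "\<sigma> \<subseteq> A" using child_above assms(2) by metis
  then have "(i, j) \<in> block_le T \<tau>" "(j, i) \<in> block_le T \<tau>"
    using assms True by (auto simp: block_le_def)
  then show ?thesis by (meson level_mono order_antisym)
next
  case False
  have "\<sigma> \<inter> \<tau> = {}" using piping_nested[OF T assms(2,3)] False assms(4) by blast
  then have "i \<notin> \<tau>" "j \<notin> \<tau>" using assms(5,6) by auto
  then show ?thesis by (simp add: level_outside)
qed

text \<open>The vanishing half of triangularity. Allowing subsets \<open>S\<close> makes it apply to
  pipes outside the piping as well.\<close>

lemma slope_level_eq_0:
  assumes "piping T" "\<sigma> \<in> T" "\<tau> \<in> T" "\<not> \<tau> \<subseteq> \<sigma>" "S \<subseteq> \<sigma>"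
  shows "slope_vec S \<bullet> level T \<tau> = 0"
proof -
  have "level T \<tau> $ j - level T \<tau> $ i = 0" if "(i, j) \<in> covers_in S" for i j
  proof -
    have "i \<in> \<sigma>" "j \<in> \<sigma>" using that assms(5) by (auto simp: covers_in_def)
    then show ?thesis using level_const[OF assms(1-4), of i j] by simp
  qed
  then show ?thesis unfolding slope_vec_inner by (intro sum.neutral) auto
qed

lemma slope_level_abs_le:
  "\<bar>slope_vec S \<bullet> level T \<tau>\<bar> \<le> real CARD('p) ^ 3" for S :: "'p::{finite,order} set"
  using slope_vec_abs_le[of "level T \<tau>" "real CARD('p)" S] level_bounds[of T \<tau>]
  by (simp add: power2_eq_square power3_eq_cube)

text \<open>Otherwise every edge of \<sigma> would stay in a child; as children are disjoint,
  connectedness would trap \<sigma> in a single one.\<close>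

lemma crossing_cover:
  fixes T :: "'p::{finite,order} set set"
  assumes T: "piping T" and \<sigma>: "pipe \<sigma>" "1 < card \<sigma>"
    and nc: "\<And>A. A \<in> children T \<tau> \<Longrightarrow> \<not> \<sigma> \<subseteq> A"
  shows "\<exists>i j. (i, j) \<in> covers_in \<sigma> \<and> \<not> (\<exists>A\<in>children T \<tau>. i \<in> A \<and> j \<in> A)"
proof (rule ccontr)
  assume "\<not> ?thesis"
  then have e0: "\<exists>A\<in>children T \<tau>. i \<in> A \<and> j \<in> A" if "(i, j) \<in> covers_in \<sigma>" for i j
    using that by blast
  have e: "\<exists>A\<in>children T \<tau>. i \<in> A \<and> j \<in> A" if "(i, j) \<in> hasse_edges_on \<sigma>" for i j
    using that e0[of i j] e0[of j i] unfolding hasse_edges_on_def covers_in_def by blast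
  obtain p q where pq: "p \<in> \<sigma>" "q \<in> \<sigma>" "p \<noteq> q"
  proof -
    have "\<not> card \<sigma> \<le> Suc 0" using \<sigma>(2) by simp
    then have "\<not> (\<forall>a\<in>\<sigma>. \<forall>b\<in>\<sigma>. a = b)" by (simp add: card_le_Suc0_iff_eq)
    then show ?thesis using that by blast
  qed
  have conn: "(p, r) \<in> (hasse_edges_on \<sigma>)\<^sup>*" if "r \<in> \<sigma>" for r
    using \<sigma>(1) pq(1) that by (auto simp: pipe_def hasse_connected_def)
  obtain s where "(p, s) \<in> hasse_edges_on \<sigma>"
    using conn[OF pq(2)] pq(3) by (meson converse_rtranclE)
  then obtain A where A: "A \<in> children T \<tau>" "p \<in> A" using e by blast
  have "r \<in> A" if "r \<in> \<sigma>" for r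
    using conn[OF that]
  proof induction
    case (step y z)
    then obtain B where "B \<in> children T \<tau>" "y \<in> B" "z \<in> B" using e by blast
    then show ?case using step.IH children_disjoint[OF T A(1), of B] by auto
  qed (rule A(2))
  then show False using nc[OF A(1)] by blast
qed

text \<open>A cover that crosses between blocks contributes at least 1, and no other cover
  contributes negatively.\<close>

lemma slope_level_ge_1:
  fixes T :: "'p::{finite,order} set set"
  assumes T: "piping T" and \<sigma>: "pipe \<sigma>" "1 < card \<sigma>" "\<sigma> \<subseteq> \<tau>"
    and nc: "\<And>A. A \<in> children T \<tau> \<Longrightarrow> \<not> \<sigma> \<subseteq> A"
  shows "1 \<le> slope_vec \<sigma> \<bullet> level T \<tau>"
proof -
  obtain i j where ij: "(i, j) \<in> covers_in \<sigma>" "\<not> (\<exists>A\<in>children T \<tau>. i \<in> A \<and> j \<in> A)"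
  proof -
    have "\<exists>i j. (i, j) \<in> covers_in \<sigma> \<and> \<not> (\<exists>A\<in>children T \<tau>. i \<in> A \<and> j \<in> A)"
      by (rule crossing_cover[OF T \<sigma>(1,2)]) (rule nc)
    then show ?thesis by (elim exE conjE) (rule that)
  qed
  have "1 \<le> (\<lambda>(i, j). level T \<tau> $ j - level T \<tau> $ i) (i, j)"
    using level_strict[OF T _ _ _ ij(2)] ij(1) \<sigma>(3)
    by (auto simp: covers_in_def covered_by_def algebra_simps)
  also have "\<dots> \<le> slope_vec \<sigma> \<bullet> level T \<tau>"
    unfolding slope_vec_inner
  proof (rule member_le_sum[OF ij(1)])
    fix e assume "e \<in> covers_in \<sigma> - {(i, j)}"
    then show "0 \<le> (case e of (i, j) \<Rightarrow> level T \<tau> $ j - level T \<tau> $ i)"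
      using \<sigma>(3)
      by (auto simp: covers_in_def covered_by_def block_le_def subset_iff less_imp_le intro!: level_mono)
  qed simp
  finally show ?thesis .
qed

lemma slope_level_self:
  fixes T :: "'p::{finite,order} set set"
  assumes "piping T" "\<tau> \<in> T" "1 < card \<tau>"
  shows "1 \<le> slope_vec \<tau> \<bullet> level T \<tau>"
  using assms(3) piping_pipe[OF assms(1,2)]
  by (intro slope_level_ge_1[OF assms(1)]) (auto simp: children_def)

text \<open>Descending induction on size: pairing with \<open>level T \<tau>\<close> kills every
  member not containing \<tau>, strictly larger members already have coefficient 0, and the diagonal
  entry is at least 1.\<close>

lemma slope_vec_independent:
  fixes T :: "'p::{finite,order} set set"
  assumes T: "piping T" and big: "\<And>\<tau>. \<tau> \<in> T \<Longrightarrow> 1 < card \<tau>"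
    and sum0: "(\<Sum>\<tau>\<in>T. u \<tau> *\<^sub>R slope_vec \<tau>) = 0" and "\<tau> \<in> T"
  shows "u \<tau> = 0"
  using \<open>\<tau> \<in> T\<close>
proof (induction "CARD('p) - card \<tau>" arbitrary: \<tau> rule: less_induct)
  case less
  have "u \<sigma> * (slope_vec \<sigma> \<bullet> level T \<tau>) = 0" if "\<sigma> \<in> T - {\<tau>}" for \<sigma>
  proof (cases "\<tau> \<subset> \<sigma>")
    case True
    then have "card \<tau> < card \<sigma>" by (simp add: psubset_card_mono)
    moreover have "card \<sigma> \<le> CARD('p)" by (simp add: card_mono)
    ultimately have "u \<sigma> = 0" using less.hyps[of \<sigma>] that by auto
    then show ?thesis by simp
  next
    case False
    then show ?thesis using that less.prems slope_level_eq_0[OF T, of \<sigma> \<tau> \<sigma>] by auto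
  qed
  then have "(\<Sum>\<sigma>\<in>T - {\<tau>}. u \<sigma> * (slope_vec \<sigma> \<bullet> level T \<tau>)) = 0"
    by (rule sum.neutral[OF ballI])
  then have "(\<Sum>\<sigma>\<in>T. u \<sigma> * (slope_vec \<sigma> \<bullet> level T \<tau>)) = u \<tau> * (slope_vec \<tau> \<bullet> level T \<tau>)"
    using less.prems by (simp add: sum.remove[of T \<tau>])
  moreover have "(\<Sum>\<sigma>\<in>T. u \<sigma> * (slope_vec \<sigma> \<bullet> level T \<tau>)) = 0"
    using arg_cong[OF sum0, of "\<lambda>v. v \<bullet> level T \<tau>"] by (simp add: inner_sum_left)
  ultimately show ?case using slope_level_self[OF T less.prems big[OF less.prems]] by auto
qed

section \<open>Realising a piping\<close>

text \<open>Forward substitution by increasing cardinality.\<close>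

lemma triangular_solve:
  fixes A :: "'a set \<Rightarrow> 'a set \<Rightarrow> real"
  assumes fin: "finite T" "\<And>\<tau>. \<tau> \<in> T \<Longrightarrow> finite \<tau>" and A: "\<And>\<tau>. \<tau> \<in> T \<Longrightarrow> A \<tau> \<tau> \<noteq> 0"
  shows "\<exists>\<mu>. \<forall>\<tau>\<in>T. \<mu> \<tau> * A \<tau> \<tau> + (\<Sum>\<sigma> | \<sigma> \<in> T \<and> \<sigma> \<subset> \<tau>. \<mu> \<sigma> * A \<tau> \<sigma>) = c \<tau>"
proof -
  have "\<exists>\<mu>. \<forall>\<tau>\<in>T. card \<tau> < k \<longrightarrow>
      \<mu> \<tau> * A \<tau> \<tau> + (\<Sum>\<sigma> | \<sigma> \<in> T \<and> \<sigma> \<subset> \<tau>. \<mu> \<sigma> * A \<tau> \<sigma>) = c \<tau>" for k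
  proof (induction k)
    case (Suc k)
    then obtain \<mu> where \<mu>: "\<And>\<tau>. \<tau> \<in> T \<Longrightarrow> card \<tau> < k \<Longrightarrow>
      \<mu> \<tau> * A \<tau> \<tau> + (\<Sum>\<sigma> | \<sigma> \<in> T \<and> \<sigma> \<subset> \<tau>. \<mu> \<sigma> * A \<tau> \<sigma>) = c \<tau>"
      by blast
    define \<nu> where "\<nu> \<tau> = (if card \<tau> = k
      then (c \<tau> - (\<Sum>\<sigma> | \<sigma> \<in> T \<and> \<sigma> \<subset> \<tau>. \<mu> \<sigma> * A \<tau> \<sigma>)) / A \<tau> \<tau> else \<mu> \<tau>)" for \<tau>
    have "\<nu> \<tau> * A \<tau> \<tau> + (\<Sum>\<sigma> | \<sigma> \<in> T \<and> \<sigma> \<subset> \<tau>. \<nu> \<sigma> * A \<tau> \<sigma>) = c \<tau>"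
      if \<tau>: "\<tau> \<in> T" "card \<tau> < Suc k" for \<tau>
    proof -
      have "\<nu> \<sigma> = \<mu> \<sigma>" if "\<sigma> \<subset> \<tau>" for \<sigma>
        using psubset_card_mono[OF fin(2)[OF \<tau>(1)] that] \<tau>(2) by (simp add: \<nu>_def)
      then have "(\<Sum>\<sigma> | \<sigma> \<in> T \<and> \<sigma> \<subset> \<tau>. \<nu> \<sigma> * A \<tau> \<sigma>) = (\<Sum>\<sigma> | \<sigma> \<in> T \<and> \<sigma> \<subset> \<tau>. \<mu> \<sigma> * A \<tau> \<sigma>)"
        by (intro sum.cong) auto
      then show ?thesis
        using \<mu>[OF \<tau>(1)] \<tau>(2) A[OF \<tau>(1)] by (cases "card \<tau> = k") (simp_all add: \<nu>_def)
    qed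
    then show ?case by blast
  qed simp
  then obtain \<mu> where \<mu>: "\<forall>\<tau>\<in>T. card \<tau> < Suc (Max (card ` T)) \<longrightarrow>
      \<mu> \<tau> * A \<tau> \<tau> + (\<Sum>\<sigma> | \<sigma> \<in> T \<and> \<sigma> \<subset> \<tau>. \<mu> \<sigma> * A \<tau> \<sigma>) = c \<tau>"
    by blast
  have "card \<tau> < Suc (Max (card ` T))" if "\<tau> \<in> T" for \<tau>
    using fin(1) that by (simp add: less_Suc_eq_le)
  then show ?thesis using \<mu> by blast
qed

text \<open>The point is a combination of level functions whose coefficients solve the tightness
  equations for \<open>T\<close> and the whole poset. Heights grow so fast that each coefficient
  dominates those of smaller members, which leaves every other pipe slack.\<close>

lemma ex_feasible_tight:
  fixes T :: "'p::{finite,order} set set"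
  assumes conn: "hasse_connected (UNIV :: 'p set)" and n2: "2 \<le> CARD('p)" and T: "proper_piping T"
  shows "\<exists>x. feasible x \<and> tight_pipes x = T"
proof -
  define T' where "T' = insert UNIV T"
  define g where "g = level T'"
  let ?a = "slope_vec :: 'p set \<Rightarrow> (real, 'p) vec"
  define n3 where "n3 = real CARD('p) ^ 3"
  \<comment> \<open>\<open>2 ^ CARD('p)\<close> bounds the number of members and \<open>n3\<close>
    each entry; \<open>growth\<close> is exactly \<open>16 * K * K\<close>.\<close>
  define K where "K = 2 ^ CARD('p) * n3"
  have pU: "pipe (UNIV :: 'p set)"
    using conn by (simp add: pipe_def order_convex_def)
  have pT: "piping T" and TP: "\<And>\<tau>. \<tau> \<in> T \<Longrightarrow> proper_pipe \<tau>"
    using T unfolding proper_piping_def by blast+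
  have P: "piping T'"
    unfolding T'_def using pT pU by (rule piping_insert_UNIV)
  have UT: "UNIV \<in> T'" by (simp add: T'_def)
  have big: "1 < card \<tau>" if "\<tau> \<in> T'" for \<tau>
    using that TP n2 by (auto simp: T'_def proper_pipe_def)
  have a1: "1 \<le> ?a \<tau> \<bullet> g \<tau>" if "\<tau> \<in> T'" for \<tau>
    unfolding g_def using P that big[OF that] by (rule slope_level_self)
  have a2: "\<bar>?a S \<bullet> g \<rho>\<bar> \<le> n3" for S \<rho>
    unfolding g_def n3_def by (rule slope_level_abs_le)
  have n3: "1 \<le> n3" using n2 by (simp add: n3_def)
  have K: "n3 \<le> K" "1 \<le> K"
  proof -
    show "n3 \<le> K" unfolding K_def using n3 by simp
    then show "1 \<le> K" using n3 by simp
  qed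
  have "(4::real) ^ CARD('p) = 2 ^ CARD('p) * 2 ^ CARD('p)"
    by (simp flip: power_mult_distrib)
  then have "growth CARD('p) = 16 * (2 ^ CARD('p) * 2 ^ CARD('p)) * (real CARD('p) ^ 3 * real CARD('p) ^ 3)"
    unfolding growth_def by (simp flip: power_add)
  then have growth: "growth CARD('p) = 16 * K * K" by (simp add: K_def n3_def)
  obtain \<mu> where \<mu>: "\<And>\<tau>. \<tau> \<in> T' \<Longrightarrow>
      \<mu> \<tau> * (?a \<tau> \<bullet> g \<tau>) + (\<Sum>\<sigma> | \<sigma> \<in> T' \<and> \<sigma> \<subset> \<tau>. \<mu> \<sigma> * (?a \<tau> \<bullet> g \<sigma>)) = height \<tau>"
    using triangular_solve[of T' "\<lambda>\<tau> \<sigma>. ?a \<tau> \<bullet> g \<sigma>" height] a1 by fastforce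
  define rest where "rest S \<tau> = (\<Sum>\<sigma> | \<sigma> \<in> T' \<and> \<sigma> \<subset> \<tau>. \<mu> \<sigma> * (?a S \<bullet> g \<sigma>))" for S \<tau>
  define x where "x = (\<Sum>\<rho>\<in>T'. \<mu> \<rho> *\<^sub>R g \<rho>)"
  \<comment> \<open>On a subset of \<tau> the forms vanish at level functions of members not inside
    \<tau>.\<close>
  have dec: "?a S \<bullet> x = \<mu> \<tau> * (?a S \<bullet> g \<tau>) + rest S \<tau>" if \<tau>: "\<tau> \<in> T'" and S: "S \<subseteq> \<tau>" for S \<tau>
  proof -
    have "?a S \<bullet> x = (\<Sum>\<rho>\<in>T'. \<mu> \<rho> * (?a S \<bullet> g \<rho>))"
      by (simp add: x_def inner_sum_right)
    also have "\<dots> = (\<Sum>\<rho>\<in>insert \<tau> {\<sigma>. \<sigma> \<in> T' \<and> \<sigma> \<subset> \<tau>}. \<mu> \<rho> * (?a S \<bullet> g \<rho>))"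
    proof (rule sum.mono_neutral_right)
      show "\<forall>\<rho>\<in>T' - insert \<tau> {\<sigma>. \<sigma> \<in> T' \<and> \<sigma> \<subset> \<tau>}. \<mu> \<rho> * (?a S \<bullet> g \<rho>) = 0"
      proof
        fix \<rho> assume "\<rho> \<in> T' - insert \<tau> {\<sigma>. \<sigma> \<in> T' \<and> \<sigma> \<subset> \<tau>}"
        then have "\<rho> \<in> T'" "\<not> \<rho> \<subseteq> \<tau>" by blast+
        then show "\<mu> \<rho> * (?a S \<bullet> g \<rho>) = 0"
          unfolding g_def using slope_level_eq_0[OF P \<tau> _ _ S] by simp
      qed
    qed (use \<tau> in auto)
    also have "\<dots> = \<mu> \<tau> * (?a S \<bullet> g \<tau>) + rest S \<tau>"
      unfolding rest_def by (subst sum.insert) auto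
    finally show ?thesis .
  qed
  have eq: "?a \<tau> \<bullet> x = height \<tau>" if "\<tau> \<in> T'" for \<tau>
    using dec[OF that order_refl] \<mu>[OF that] by (simp add: rest_def)
  have rest_small: "\<bar>rest S \<tau>\<bar> * (8 * K) \<le> height \<tau>"
    if le: "\<And>\<rho>. \<rho> \<in> T' \<Longrightarrow> \<rho> \<subset> \<tau> \<Longrightarrow> \<bar>\<mu> \<rho>\<bar> \<le> 2 * height \<rho>" for S \<tau>
  proof -
    \<comment> \<open>Strictly smaller members have height at most \<open>h\<close>, because losing
      an element costs a factor \<open>growth\<close>.\<close>
    define h where "h = height \<tau> / growth CARD('p)"
    have h: "height \<rho> \<le> h" if "\<rho> \<subset> \<tau>" for \<rho>
    proof -
      have "growth CARD('p) * height \<rho> \<le> height \<tau>"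
        using that by (intro height_growth psubset_card_mono) auto
      then show ?thesis using growth_pos[where 'p='p] by (simp add: h_def field_simps)
    qed
    have h0: "0 \<le> h" using growth_pos[where 'p='p] height_pos[of \<tau>] by (simp add: h_def)
    have "\<bar>rest S \<tau>\<bar> \<le> (\<Sum>\<sigma> | \<sigma> \<in> T' \<and> \<sigma> \<subset> \<tau>. \<bar>\<mu> \<sigma> * (?a S \<bullet> g \<sigma>)\<bar>)"
      unfolding rest_def by (rule sum_abs)
    also have "\<dots> \<le> real (card {\<sigma>. \<sigma> \<in> T' \<and> \<sigma> \<subset> \<tau>}) * (2 * h * n3)"
    proof (rule sum_bounded_above)
      fix \<sigma> assume \<sigma>: "\<sigma> \<in> {\<sigma>. \<sigma> \<in> T' \<and> \<sigma> \<subset> \<tau>}"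
      then have "\<bar>\<mu> \<sigma>\<bar> \<le> 2 * h" using le[of \<sigma>] h[of \<sigma>] by simp
      then show "\<bar>\<mu> \<sigma> * (?a S \<bullet> g \<sigma>)\<bar> \<le> 2 * h * n3"
        unfolding abs_mult using a2 h0 by (intro mult_mono) auto
    qed
    also have "\<dots> \<le> 2 ^ CARD('p) * (2 * h * n3)"
    proof (rule mult_right_mono)
      have "card {\<sigma>. \<sigma> \<in> T' \<and> \<sigma> \<subset> \<tau>} \<le> CARD('p set)" by (rule card_mono) auto
      then have "card {\<sigma>. \<sigma> \<in> T' \<and> \<sigma> \<subset> \<tau>} \<le> 2 ^ CARD('p)" by (simp add: card_set)
      then have "real (card {\<sigma>. \<sigma> \<in> T' \<and> \<sigma> \<subset> \<tau>}) \<le> real (2 ^ CARD('p))" by (rule of_nat_mono)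
      then show "real (card {\<sigma>. \<sigma> \<in> T' \<and> \<sigma> \<subset> \<tau>}) \<le> 2 ^ CARD('p)" by simp
      show "0 \<le> 2 * h * n3" using h0 n3 by simp
    qed
    also have "\<dots> = 2 * K * h" by (simp add: K_def)
    \<comment> \<open>Of the factor \<open>16 * K * K\<close>, a part \<open>2 * K\<close> pays for
      the sum and \<open>8 * K\<close> remains as margin.\<close>
    finally have "\<bar>rest S \<tau>\<bar> * (8 * K) \<le> 2 * K * h * (8 * K)"
      using K(2) by (intro mult_right_mono) auto
    also have "\<dots> = growth CARD('p) * h" by (simp add: growth)
    also have "\<dots> = height \<tau>" using growth_pos[where 'p='p] by (simp add: h_def)
    finally show ?thesis .
  qed
  have rest_le: "8 * \<bar>r\<bar> \<le> h" if "\<bar>r\<bar> * (8 * K) \<le> h" for r h :: real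
  proof -
    have "8 * \<bar>r\<bar> * 1 \<le> 8 * \<bar>r\<bar> * K" using K(2) by (intro mult_left_mono) auto
    then show ?thesis using that by (simp add: ac_simps)
  qed
  \<comment> \<open>The diagonal entry is at least 1, so the coefficient is bounded by height plus
    rest.\<close>
  have \<mu>_le: "\<bar>\<mu> \<tau>\<bar> \<le> 2 * height \<tau>" if "\<tau> \<in> T'" for \<tau>
    using that
  proof (induction "card \<tau>" arbitrary: \<tau> rule: less_induct)
    case less
    have "\<bar>rest \<tau> \<tau>\<bar> * (8 * K) \<le> height \<tau>"
      using less.hyps by (intro rest_small) (auto simp: psubset_card_mono)
    then have r: "8 * \<bar>rest \<tau> \<tau>\<bar> \<le> height \<tau>" by (rule rest_le)
    have "\<bar>\<mu> \<tau>\<bar> * 1 \<le> \<bar>\<mu> \<tau>\<bar> * (?a \<tau> \<bullet> g \<tau>)"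
      using a1[OF less.prems] by (intro mult_left_mono) auto
    also have "\<dots> = \<bar>\<mu> \<tau> * (?a \<tau> \<bullet> g \<tau>)\<bar>" using a1[OF less.prems] by (simp add: abs_mult)
    also have "\<dots> = \<bar>height \<tau> - rest \<tau> \<tau>\<bar>" using \<mu>[OF less.prems] by (simp add: rest_def algebra_simps)
    also have "\<dots> \<le> 2 * height \<tau>" using r height_pos[of \<tau>] by linarith
    finally show ?case by simp
  qed
  have rest: "\<bar>rest S \<tau>\<bar> * (8 * K) \<le> height \<tau>" for S \<tau>
    using \<mu>_le by (intro rest_small) auto
  \<comment> \<open>The diagonal entry is at most \<open>n3\<close>, which bounds the coefficient
    from below.\<close>
  have \<mu>_ge: "height \<tau> \<le> 2 * (n3 * \<mu> \<tau>)" if "\<tau> \<in> T'" for \<tau>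
  proof -
    have *: "height \<tau> \<le> 2 * (\<mu> \<tau> * (?a \<tau> \<bullet> g \<tau>))"
      using \<mu>[OF that] rest_le[OF rest, of \<tau> \<tau>] height_pos[of \<tau>] unfolding rest_def[symmetric] by linarith
    then have "0 < \<mu> \<tau> * (?a \<tau> \<bullet> g \<tau>)" using height_pos[of \<tau>] by linarith
    then have "0 < \<mu> \<tau>" using a1[OF that] by (simp add: zero_less_mult_iff)
    then have "\<mu> \<tau> * (?a \<tau> \<bullet> g \<tau>) \<le> \<mu> \<tau> * n3"
      using a2[of \<tau> \<tau>] by (intro mult_left_mono) auto
    then show ?thesis using * by (simp add: mult.commute)
  qed
  have strict: "height \<sigma> < ?a \<sigma> \<bullet> x" if \<sigma>: "pipe \<sigma>" "1 < card \<sigma>" "\<sigma> \<notin> T'" for \<sigma>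
  proof -
    \<comment> \<open>A minimal member containing \<sigma>; \<open>UNIV\<close> shows that there is
      one. By minimality none of its children contains \<sigma>.\<close>
    obtain \<tau> where "\<tau> \<in> {\<tau> \<in> T'. \<sigma> \<subseteq> \<tau>}" "\<forall>\<rho>\<in>{\<tau> \<in> T'. \<sigma> \<subseteq> \<tau>}. \<rho> \<subseteq> \<tau> \<longrightarrow> \<tau> = \<rho>"
      using finite_has_minimal[of "{\<tau> \<in> T'. \<sigma> \<subseteq> \<tau>}"] UT by auto
    then have \<tau>: "\<tau> \<in> T'" "\<sigma> \<subseteq> \<tau>" and min: "\<And>\<rho>. \<rho> \<in> T' \<Longrightarrow> \<sigma> \<subseteq> \<rho> \<Longrightarrow> \<rho> \<subseteq> \<tau> \<Longrightarrow> \<tau> = \<rho>"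
      by auto
    have "1 \<le> ?a \<sigma> \<bullet> g \<tau>"
      unfolding g_def
    proof (rule slope_level_ge_1[OF P \<sigma>(1,2) \<tau>(2)])
      fix A assume "A \<in> children T' \<tau>"
      then show "\<not> \<sigma> \<subseteq> A" using min[of A] by (auto simp: children_def)
    qed
    have "\<sigma> \<subset> \<tau>" using \<tau> \<sigma>(3) by blast
    then have small: "growth CARD('p) * height \<sigma> \<le> height \<tau>"
      by (intro height_growth psubset_card_mono) auto
    have "0 < n3 * \<mu> \<tau>" using \<mu>_ge[OF \<tau>(1)] height_pos[of \<tau>] by linarith
    then have "0 < \<mu> \<tau>" using n3 by (simp add: zero_less_mult_iff)
    then have "\<mu> \<tau> * 1 \<le> \<mu> \<tau> * (?a \<sigma> \<bullet> g \<tau>)"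
      using \<open>1 \<le> ?a \<sigma> \<bullet> g \<tau>\<close> by (intro mult_left_mono) auto
    then have "\<mu> \<tau> - \<bar>rest \<sigma> \<tau>\<bar> \<le> ?a \<sigma> \<bullet> x"
      using dec[OF \<tau>] by linarith
    then have "n3 * (\<mu> \<tau> - \<bar>rest \<sigma> \<tau>\<bar>) \<le> n3 * (?a \<sigma> \<bullet> x)"
      using n3 by (intro mult_left_mono) auto
    then have 1: "n3 * \<mu> \<tau> - n3 * \<bar>rest \<sigma> \<tau>\<bar> \<le> n3 * (?a \<sigma> \<bullet> x)"
      by (simp only: right_diff_distrib)
    have "n3 * \<bar>rest \<sigma> \<tau>\<bar> \<le> K * \<bar>rest \<sigma> \<tau>\<bar>" using K(1) by (intro mult_right_mono) auto
    then have 2: "8 * (n3 * \<bar>rest \<sigma> \<tau>\<bar>) \<le> height \<tau>"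
      using rest[of \<sigma> \<tau>] by (simp add: ac_simps)
    have "1 * n3 \<le> K * K" using K n3 by (intro mult_mono) auto
    then have "16 * n3 * height \<sigma> \<le> growth CARD('p) * height \<sigma>"
      using height_pos[of \<sigma>] unfolding growth by (intro mult_right_mono) auto
    then have 3: "16 * (n3 * height \<sigma>) \<le> height \<tau>" using small by simp
    \<comment> \<open>With \<open>h = height \<tau>\<close>, the right side is at least
      \<open>h/2 - h/8\<close>, the left side at most \<open>h/16\<close>.\<close>
    have "n3 * height \<sigma> < n3 * (?a \<sigma> \<bullet> x)"
      using 1 2 3 \<mu>_ge[OF \<tau>(1)] height_pos[of \<tau>] by linarith
    then show ?thesis using n3 by simp
  qed
  have "feasible x"
    unfolding feasible_def
  proof (intro conjI allI impI)
    fix \<sigma> :: "'p set" assume "pipe \<sigma> \<and> 1 < card \<sigma>"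
    then show "height \<sigma> \<le> ?a \<sigma> \<bullet> x" using eq[of \<sigma>] strict[of \<sigma>] by (cases "\<sigma> \<in> T'") auto
  qed (rule eq[OF UT])
  moreover have "tight_pipes x = T"
  proof (intro equalityI subsetI)
    fix \<sigma> assume "\<sigma> \<in> tight_pipes x"
    then have \<sigma>: "proper_pipe \<sigma>" "?a \<sigma> \<bullet> x = height \<sigma>" by (auto simp: tight_pipes_def)
    then have "\<sigma> \<in> T'" using strict[of \<sigma>] by (auto simp: proper_pipe_def)
    then show "\<sigma> \<in> T" using \<sigma>(1) by (auto simp: T'_def proper_pipe_def)
  next
    fix \<sigma> assume "\<sigma> \<in> T"
    then show "\<sigma> \<in> tight_pipes x" using TP eq[of \<sigma>] by (auto simp: tight_pipes_def T'_def)
  qed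
  ultimately show ?thesis by blast
qed

section \<open>The polytope\<close>

lemma dim_orthogonal_pair:
  fixes a b :: "'e::euclidean_space"
  assumes "a \<noteq> 0" "b \<noteq> 0" "a \<bullet> b = 0"
  shows "dim {y. a \<bullet> y = 0 \<and> b \<bullet> y = 0} = DIM('e) - 2"
proof -
  have ab: "a \<noteq> b" using assms by auto
  have "pairwise orthogonal {a, b}"
    using assms(3) by (auto simp: pairwise_def orthogonal_def inner_commute)
  then have "independent {a, b}"
    using assms by (intro pairwise_orthogonal_independent) auto
  then have "dim (span {a, b}) = 2" using ab by (simp add: dim_eq_card_independent)
  moreover have "dim {y \<in> UNIV. \<forall>x\<in>span {a, b}. orthogonal x y} + dim (span {a, b}) = dim (UNIV :: 'e set)"
    by (rule dim_subspace_orthogonal_to_vectors) auto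
  moreover have "{y \<in> UNIV. \<forall>x\<in>span {a, b}. orthogonal x y} = {y. a \<bullet> y = 0 \<and> b \<bullet> y = 0}"
  proof (intro equalityI subsetI)
    fix y assume "y \<in> {y. a \<bullet> y = 0 \<and> b \<bullet> y = 0}"
    then have "orthogonal y x" if "x \<in> span {a, b}" for x
      using that by (intro orthogonal_to_span[of x "{a, b}"]) (auto simp: orthogonal_def inner_commute)
    then show "y \<in> {y \<in> UNIV. \<forall>x\<in>span {a, b}. orthogonal x y}"
      by (simp add: orthogonal_commute)
  next
    fix y assume "y \<in> {y \<in> UNIV. \<forall>x\<in>span {a, b}. orthogonal x y}"
    then show "y \<in> {y. a \<bullet> y = 0 \<and> b \<bullet> y = 0}"
      by (auto simp: orthogonal_def intro: span_base)
  qed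
  ultimately show ?thesis by (simp add: dim_UNIV)
qed

text \<open>Each cover is a pipe, so \<open>y\<close> does not decrease along it; the increments sum
  to 0 and hence vanish, and connectedness does the rest. This yields the condition
  \<open>pos\<close> of the polar dual.\<close>

lemma slope_nonneg_imp_constant:
  fixes y :: "real ^ 'p::{finite,order}"
  assumes conn: "hasse_connected (UNIV :: 'p set)" and zero: "slope_vec UNIV \<bullet> y = 0"
    and nonneg: "\<And>\<tau>. proper_pipe \<tau> \<Longrightarrow> 0 \<le> slope_vec \<tau> \<bullet> y"
  shows "y $ i = y $ j"
proof -
  have nn: "0 \<le> y $ l - y $ k" if "covered_by k l" for k l
  proof -
    note kl = pipe_cover[OF that]
    \<comment> \<open>In a two-element poset the cover is not a proper pipe, and \<open>zero\<close>
      takes over.\<close>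
    have "0 \<le> slope_vec {k, l} \<bullet> y"
    proof (cases "{k, l} = UNIV")
      case False
      then have "card {k, l} < CARD('p)" by (intro psubset_card_mono) auto
      then show ?thesis using kl by (intro nonneg) (simp add: proper_pipe_def)
    qed (use zero in simp)
    then show ?thesis by (simp add: slope_vec_inner kl(3))
  qed
  have "\<forall>e\<in>covers_in UNIV. (case e of (i, j) \<Rightarrow> y $ j - y $ i) = 0"
    using zero nn unfolding slope_vec_inner
    by (subst sum_nonneg_eq_0_iff[symmetric]) (auto simp: covers_in_def)
  then have eq: "y $ l = y $ k" if "covered_by k l" for k l
    using that by (force simp: covers_in_def)
  have "(i, j) \<in> (hasse_edges_on UNIV)\<^sup>*" using conn by (simp add: hasse_connected_def)
  then show ?thesis
    by induction (auto simp: hasse_edges_on_def dest: eq)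
qed

theorem theorem1p2:
  assumes "hasse_connected (UNIV :: 'p::{finite,order} set)"
    and "CARD('p) \<ge> 2"
  shows "\<exists>Q :: (real ^ 'p::{finite,order}) set.
           simplicial_polytope Q \<and>
           aff_dim Q = int CARD('p) - 2 \<and>
           complex_isomorphic (boundary_complex Q) (piping_complex :: 'p set set set)"
proof -
  let ?K = "piping_complex :: 'p set set set"
  let ?a = "slope_vec :: 'p set \<Rightarrow> (real, 'p) vec"
  define U where "U = ?a UNIV"
  define one :: "(real, 'p) vec" where "one = (\<chi> i. 1)"
  have one: "?a S \<bullet> one = 0" for S
    by (simp add: slope_vec_inner one_def)
  have one1: "one \<bullet> one = real CARD('p)"
    by (simp add: one_def inner_vec_def)
  have ex: "\<exists>x. feasible x \<and> tight_pipes x = T" if "T \<in> ?K" for T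
    using ex_feasible_tight[OF assms] that by (simp add: piping_complex_def)
  \<comment> \<open>The empty piping yields a point where every proper pipe is slack, the centre of
    the polar dual.\<close>
  have "{} \<in> ?K"
    by (simp add: piping_complex_def proper_piping_def piping_def piping_digraph_def acyclic_def)
  then obtain x0 :: "(real, 'p) vec" where x0: "feasible x0" "tight_pipes x0 = {}" using ex by blast
  define s where "s \<tau> = ?a \<tau> \<bullet> x0 - height \<tau>" for \<tau>
  define t where "t \<tau> = (?a \<tau> \<bullet> U) / (U \<bullet> U)" for \<tau>
  \<comment> \<open>The form is projected off \<open>U\<close> and divided by minus its slack, so
    that for \<open>y \<in> L\<close> the condition \<open>v \<tau> \<bullet> y \<le> 1\<close> is
    the facet inequality at \<open>x0 + y\<close>.\<close>
  define v where "v \<tau> = - (1 / s \<tau>) *\<^sub>R (?a \<tau> - t \<tau> *\<^sub>R U)" for \<tau>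
  \<comment> \<open>Directions that preserve the equality for the whole poset, with constants
    removed: two conditions, hence dimension \<open>CARD('p) - 2\<close>.\<close>
  define L where "L = {y. one \<bullet> y = 0 \<and> U \<bullet> y = 0}"
  have s: "0 < s \<tau>" if "proper_pipe \<tau>" for \<tau>
  proof -
    have "height \<tau> \<le> ?a \<tau> \<bullet> x0" using x0(1) that by (simp add: feasible_def proper_pipe_def)
    moreover have "?a \<tau> \<bullet> x0 \<noteq> height \<tau>" using x0(2) that by (auto simp: tight_pipes_def)
    ultimately show ?thesis by (simp add: s_def)
  qed
  have "U \<bullet> x0 = height (UNIV :: 'p set)" using x0(1) by (simp add: U_def feasible_def)
  then have U0: "U \<noteq> 0" using height_pos[of "UNIV :: 'p set"] by auto
  have one0: "one \<noteq> 0" using one1 by auto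
  have L: "subspace L" by (auto simp: L_def subspace_def inner_add_right)
  have oneU: "one \<bullet> U = 0" using one[of UNIV] by (simp add: U_def inner_commute)
  have dimL: "int (dim L) = int CARD('p) - 2"
    unfolding L_def using dim_orthogonal_pair[OF one0 U0 oneU] assms(2) by simp
  have vL: "v \<tau> \<in> L" for \<tau>
  proof -
    have "one \<bullet> v \<tau> = 0"
      using oneU one[of \<tau>] by (simp add: v_def inner_diff_right inner_commute[of one "?a \<tau>"])
    moreover have "U \<bullet> v \<tau> = 0"
      using U0 by (simp add: v_def t_def inner_diff_right inner_commute[of U "?a \<tau>"])
    ultimately show ?thesis by (simp add: L_def)
  qed
  have vy: "v \<tau> \<bullet> y = - (?a \<tau> \<bullet> y) / s \<tau>" if "y \<in> L" for \<tau> y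
    using that by (simp add: v_def L_def inner_diff_left)
  have v_le: "v \<tau> \<bullet> y \<le> 1 \<longleftrightarrow> height \<tau> \<le> ?a \<tau> \<bullet> (x0 + y)"
    and v_eq: "v \<tau> \<bullet> y = 1 \<longleftrightarrow> ?a \<tau> \<bullet> (x0 + y) = height \<tau>"
    if "y \<in> L" "proper_pipe \<tau>" for y \<tau>
    using s[OF that(2)] unfolding vy[OF that(1)]
    by (auto simp: field_simps inner_add_right s_def)
  have "\<exists>Q :: (real, 'p) vec set. simplicial_polytope Q \<and> aff_dim Q = int (dim L) \<and>
      complex_isomorphic (boundary_complex Q) ?K"
  proof (rule polar_simplicial[where V = "{\<tau>. proper_pipe \<tau>}" and v = v, OF _ L])
    fix y assume y: "y \<in> L" and le: "\<And>\<tau>. \<tau> \<in> {\<tau>. proper_pipe \<tau>} \<Longrightarrow> v \<tau> \<bullet> y \<le> 0"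
    have "0 \<le> ?a \<tau> \<bullet> y" if "proper_pipe \<tau>" for \<tau>
      using le[of \<tau>] s[OF that] that unfolding vy[OF y] by (simp add: zero_le_divide_iff)
    moreover have "?a UNIV \<bullet> y = 0" using y by (simp add: L_def U_def)
    ultimately have const: "y $ i = y $ j" for i j
      using slope_nonneg_imp_constant[OF assms(1)] by blast
    have "one \<bullet> y = real CARD('p) * y $ i" for i
    proof -
      have "one \<bullet> y = (\<Sum>j\<in>UNIV. y $ j)" by (simp add: one_def inner_vec_def)
      also have "\<dots> = (\<Sum>j\<in>(UNIV :: 'p set). y $ i)" by (intro sum.cong const refl)
      finally show ?thesis by simp
    qed
    then have "y $ i = 0" for i using y by (simp add: L_def)
    then show "y = 0" by (simp add: vec_eq_iff)
  next
    fix y assume y: "y \<in> L" and le: "\<And>\<tau>. \<tau> \<in> {\<tau>. proper_pipe \<tau>} \<Longrightarrow> v \<tau> \<bullet> y \<le> 1"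
    have U: "?a UNIV \<bullet> (x0 + y) = height (UNIV :: 'p set)"
      using x0(1) y by (simp add: feasible_def L_def U_def inner_add_right)
    have "feasible (x0 + y)"
      unfolding feasible_def
    proof (intro conjI allI impI)
      fix \<tau> :: "'p set" assume \<tau>: "pipe \<tau> \<and> 1 < card \<tau>"
      show "height \<tau> \<le> ?a \<tau> \<bullet> (x0 + y)"
      proof (cases "\<tau> = UNIV")
        case False
        then have "card \<tau> < CARD('p)" by (intro psubset_card_mono) auto
        then have "proper_pipe \<tau>" using \<tau> by (simp add: proper_pipe_def)
        then show ?thesis using le v_le[OF y] by blast
      qed (use U in simp)
    qed (rule U)
    then have "tight_pipes (x0 + y) \<in> ?K"
      using tight_pipes_proper_piping by (simp add: piping_complex_def)
    moreover have "tight_pipes (x0 + y) = {\<tau> \<in> {\<tau>. proper_pipe \<tau>}. v \<tau> \<bullet> y = 1}"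
      using v_eq[OF y] by (auto simp: tight_pipes_def)
    ultimately show "{\<tau> \<in> {\<tau>. proper_pipe \<tau>}. v \<tau> \<bullet> y = 1} \<in> ?K" by simp
  next
    fix T assume "T \<in> ?K"
    then obtain x :: "(real, 'p) vec" where x: "feasible x" "tight_pipes x = T" using ex by blast
    \<comment> \<open>Subtracting the mean moves \<open>x - x0\<close> into \<open>L\<close>; the
      forms vanish on constants and do not change.\<close>
    define y where "y = (x - x0) - ((one \<bullet> (x - x0)) / real CARD('p)) *\<^sub>R one"
    have ay: "?a \<tau> \<bullet> (x0 + y) = ?a \<tau> \<bullet> x" for \<tau>
      by (simp add: y_def one inner_add_right inner_diff_right)
    have "U \<bullet> y = 0"
      using x(1) x0(1) one[of UNIV] by (simp add: y_def U_def feasible_def inner_diff_right)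
    moreover have "one \<bullet> y = 0" by (simp add: y_def inner_diff_right one1)
    ultimately have yL: "y \<in> L" by (simp add: L_def)
    have "v \<tau> \<bullet> y \<le> 1" if "proper_pipe \<tau>" for \<tau>
      using v_le[OF yL that] ay[of \<tau>] x(1) that by (simp add: feasible_def proper_pipe_def)
    moreover have "{\<tau> \<in> {\<tau>. proper_pipe \<tau>}. v \<tau> \<bullet> y = 1} = T"
      using v_eq[OF yL] x(2) by (auto simp: tight_pipes_def ay)
    ultimately show "\<exists>y\<in>L. (\<forall>\<tau>\<in>{\<tau>. proper_pipe \<tau>}. v \<tau> \<bullet> y \<le> 1) \<and>
        {\<tau> \<in> {\<tau>. proper_pipe \<tau>}. v \<tau> \<bullet> y = 1} = T"
      using yL by blast
  next
    fix T u \<tau> assume T: "T \<in> ?K" and sum0: "(\<Sum>\<sigma>\<in>T. u \<sigma> *\<^sub>R v \<sigma>) = 0" and \<tau>: "\<tau> \<in> T"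
    have pT: "piping T" and TP: "\<And>\<sigma>. \<sigma> \<in> T \<Longrightarrow> proper_pipe \<sigma>"
      using T unfolding piping_complex_def proper_piping_def by blast+
    have nU: "UNIV \<notin> T" using TP by (auto simp: proper_pipe_def)
    \<comment> \<open>A relation among the \<open>v \<sigma>\<close> becomes one among the forms
      themselves; the projection terms along \<open>U\<close> collect in the coefficient of
      \<open>UNIV\<close>.\<close>
    define w where "w \<sigma> = (if \<sigma> = UNIV then \<Sum>\<rho>\<in>T. u \<rho> / s \<rho> * t \<rho> else - (u \<sigma> / s \<sigma>))" for \<sigma>
    have "pipe (UNIV :: 'p set)" using assms(1) by (simp add: pipe_def order_convex_def)
    then have P: "piping (insert UNIV T)" by (rule piping_insert_UNIV[OF pT])
    have "(\<Sum>\<sigma>\<in>insert UNIV T. w \<sigma> *\<^sub>R ?a \<sigma>) =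
        (\<Sum>\<rho>\<in>T. u \<rho> / s \<rho> * t \<rho>) *\<^sub>R U + (\<Sum>\<sigma>\<in>T. - (u \<sigma> / s \<sigma>) *\<^sub>R ?a \<sigma>)"
      using nU by (auto simp: w_def U_def intro!: sum.cong)
    also have "\<dots> = (\<Sum>\<sigma>\<in>T. u \<sigma> *\<^sub>R v \<sigma>)"
      by (simp add: v_def scaleR_sum_left sum.distrib[symmetric] algebra_simps sum_subtractf)
    finally have "(\<Sum>\<sigma>\<in>insert UNIV T. w \<sigma> *\<^sub>R ?a \<sigma>) = 0" using sum0 by simp
    moreover have "1 < card \<sigma>" if "\<sigma> \<in> insert UNIV T" for \<sigma>
      using that TP assms(2) by (auto simp: proper_pipe_def)
    ultimately have "w \<tau> = 0"
      using slope_vec_independent[OF P, of w \<tau>] \<tau> by blast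
    then show "u \<tau> = 0"
      using nU \<tau> s[OF TP[OF \<tau>]] by (auto simp: w_def split: if_splits)
  next
    fix \<tau> assume "\<tau> \<in> {\<tau>. proper_pipe (\<tau> :: 'p set)}"
    then have "\<tau> \<in> \<Union>?K" unfolding vertices_piping_complex .
    then show "{\<tau>} \<in> ?K" using piping_complex_mono by blast
  qed (use vL in auto)
  then show ?thesis unfolding dimL .
qed

end
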